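(* Let $\epsilon>0$, let $a\in\mathbb{Z}$ with $a\ne0$, and let $d\in\mathbb{N}$. For a positive proportion of polynomials $P(t)\in\mathbb{Z}[t]$ of degree $d$ (ordered by height), the equation $x^2-ay^2=P(t)z^2$ has a solution $(x,y,z,t)\in\mathbb{N}^4$ with $$\max\{x,y,z,t\}\le|a|^{1/2}|P|^{1/2}(\log|P|)^{d/2+\epsilon}.$$
   Context: $\mathbb{N}$ is the set of positive integers. The height $|P|$ of $P\in\mathbb{Z}[t]$ is the maximum of the absolute values of its coefficients. "For a positive proportion" means that the proportion, among all integer polynomials of degree $d$ and height at most $H$, of those with the property has positive $\liminf$ as $H\to\infty$. *)

theory Defs
  imports "HOL-Analysis.Analysis" "HOL-Computational_Algebra.Polynomial"
begin

definition height :: "int poly \<Rightarrow> int" where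
  "height P = Max ((\<lambda>i. \<bar>coeff P i\<bar>) ` {..degree P})"

definition polys_of_height_at_most :: "nat \<Rightarrow> nat \<Rightarrow> int poly set" where
  "polys_of_height_at_most d H = {P. degree P = d \<and> height P \<le> int H}"

lemma finite_polys_of_height_at_most: "finite (polys_of_height_at_most d H)"
proof -
  let ?L = "{xs. set xs \<subseteq> {- int H..int H} \<and> length xs = Suc d}"
  have "polys_of_height_at_most d H \<subseteq> Poly ` ?L"
  proof
    fix P assume P: "P \<in> polys_of_height_at_most d H"
    let ?xs = "map (coeff P) [0..<Suc d]"
    have deg: "degree P = d" and hgt: "height P \<le> int H"
      using P by (auto simp: polys_of_height_at_most_def)
    have "\<bar>coeff P i\<bar> \<le> int H" if "i \<le> d" for i
    proof -
      have "\<bar>coeff P i\<bar> \<le> height P"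
        unfolding height_def using that deg by (intro Max_ge) auto
      then show ?thesis using hgt by simp
    qed
    then have "set ?xs \<subseteq> {- int H..int H}"
      by (fastforce simp: abs_le_iff less_Suc_eq_le simp del: upt_Suc)
    moreover have "P = Poly ?xs"
      by (rule poly_eqI)
        (use deg in \<open>auto simp: coeff_Poly_eq nth_default_def coeff_eq_0 simp del: upt_Suc\<close>)
    ultimately show "P \<in> Poly ` ?L"
      by (intro image_eqI[of _ _ ?xs] CollectI conjI) simp_all
  qed
  then show ?thesis
    by (rule finite_subset) (intro finite_imageI finite_lists_length_eq, simp)
qed

text \<open>The height is an integer, so a natural number bound \<open>H\<close> loses nothing compared to a real
  one. The lower limit is taken in the extended reals, where it always exists; for \<open>H = 0\<close> and
  \<open>d > 0\<close> the quotient is \<open>0 / 0 = 0\<close>, which does not affect it.\<close>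

definition positive_proportion :: "nat \<Rightarrow> (int poly \<Rightarrow> bool) \<Rightarrow> bool" where
  "positive_proportion d Q \<longleftrightarrow>
     0 < liminf (\<lambda>H. ereal (real (card {P \<in> polys_of_height_at_most d H. Q P}) /
                            real (card (polys_of_height_at_most d H))))"

end

theory Submission
  imports Defs "HOL-Real_Asymp.Real_Asymp"
begin

text \<open>A second moment argument with \<open>z = 1\<close>. Let \<open>h = H div 2\<close> and \<open>T = \<lceil>ln h\<rceil>\<close>, let the coefficients of
  \<open>P\<close> range over \<open>{h..<2 h}\<close>, and let \<open>N(P)\<close> count the triples \<open>(t, x, y)\<close> with \<open>T \<le> t < 2 T\<close>,
  \<open>x\<close> and \<open>y\<close> of order \<open>\<surd>(h T^d)\<close> and \<open>x\<^sup>2 - a y\<^sup>2 = P(t)\<close>. Counting squares in the interval swept out by the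
  constant coefficient shows that the mean of \<open>N\<close> is at least a constant times \<open>T\<close>. In the second
  moment, the pairs with \<open>t\<^sub>1 = t\<^sub>2\<close> contribute on average \<open>O(T ln h)\<close>, because the quadruples with
  \<open>x\<^sub>1\<^sup>2 - a y\<^sub>1\<^sup>2 = x\<^sub>2\<^sup>2 - a y\<^sub>2\<^sup>2\<close> in a box of side \<open>S\<close> number \<open>O(S\<^sup>2 ln S)\<close>. For \<open>t\<^sub>1 \<noteq> t\<^sub>2\<close> the two
  values are congruent modulo \<open>q = |t\<^sub>1 - t\<^sub>2|\<close> and determine the two lowest coefficients, and
  the number of solutions of the congruence modulo \<open>q\<close> is \<open>O(q\<^sup>3)\<close> on average over \<open>q\<close>, so that these pairs
  contribute \<open>O(T\<^sup>2)\<close>. As \<open>T \<ge> ln h\<close>, the Cauchy--Schwarz inequality gives \<open>N(P) > 0\<close> for a positive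
  proportion of \<open>P\<close>.\<close>

subsection \<open>Integers in intervals and residue classes\<close>

lemma card_ints_half_open_ge:
  fixes \<alpha> \<beta> :: real
  shows "\<beta> - \<alpha> - 1 \<le> real (card {x :: int. \<alpha> \<le> x \<and> x < \<beta>})"
proof -
  have "{x :: int. \<alpha> \<le> x \<and> x < \<beta>} = {\<lceil>\<alpha>\<rceil>..<\<lceil>\<beta>\<rceil>}"
    by (auto simp: ceiling_le_iff less_ceiling_iff)
  then show ?thesis by simp linarith
qed

text \<open>The roots fill \<open>[sqrt m, sqrt (m + h))\<close>, whose length is
  \<open>h / (sqrt (m + h) + sqrt m)\<close> and thus at least \<open>h / (2 * S)\<close>; a
  half-open interval loses at most one integer against its length.\<close>

lemma card_squares_in_interval_ge:
  fixes m h :: int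
  assumes "m > 0" "h \<ge> 0" "real_of_int (m + h) \<le> S\<^sup>2" "S > 0"
  shows "h / (2 * S) - 1 \<le> real (card {x :: int. x > 0 \<and> m \<le> x\<^sup>2 \<and> x\<^sup>2 < m + h})"
proof -
  have "{x :: int. sqrt m \<le> x \<and> x < sqrt (m + h)} = {x :: int. x > 0 \<and> m \<le> x\<^sup>2 \<and> x\<^sup>2 < m + h}"
    (is "?A = ?B")
  proof (intro set_eqI)
    fix x :: int
    have sm: "sqrt (real_of_int m) > 0" using assms by simp
    have 1: "m \<le> x\<^sup>2 \<longleftrightarrow> sqrt m \<le> x" if "x > 0"
    proof -
      have "m \<le> x\<^sup>2 \<longleftrightarrow> real_of_int m \<le> (real_of_int x)\<^sup>2"
        by (metis of_int_le_iff of_int_power)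
      also have "\<dots> \<longleftrightarrow> sqrt m \<le> x"
        using that by (metis of_int_0_less_iff order_less_imp_le real_sqrt_le_iff real_sqrt_unique)
      finally show ?thesis .
    qed
    have 2: "x\<^sup>2 < m + h \<longleftrightarrow> x < sqrt (m + h)" if "x > 0"
    proof -
      have "x\<^sup>2 < m + h \<longleftrightarrow> (real_of_int x)\<^sup>2 < real_of_int (m + h)"
        by (metis of_int_less_iff of_int_power)
      also have "\<dots> \<longleftrightarrow> x < sqrt (m + h)"
        using that by (metis of_int_0_less_iff order_less_imp_le real_sqrt_less_iff real_sqrt_unique)
      finally show ?thesis .
    qed
    have 3: "x > 0" if "sqrt m \<le> x" using that sm by linarith
    show "x \<in> ?A \<longleftrightarrow> x \<in> ?B" using 1 2 3 by auto
  qed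
  moreover have "h / (2 * S) \<le> sqrt (m + h) - sqrt m"
  proof -
    have s: "sqrt (m + h) \<le> S"
      using assms real_le_lsqrt by fastforce
    have s2: "sqrt m \<le> sqrt (m + h)" using assms by simp
    have "h = (sqrt (m + h) - sqrt m) * (sqrt (m + h) + sqrt m)"
      using assms by (simp add: algebra_simps flip: power2_eq_square)
    also have "\<dots> \<le> (sqrt (m + h) - sqrt m) * (2 * S)"
      using s s2 by (intro mult_left_mono) linarith+
    finally show ?thesis using assms by (simp add: field_simps)
  qed
  ultimately show ?thesis using card_ints_half_open_ge[of "sqrt (m + h)" "sqrt m"] by simp
qed

text \<open>Subtracting the minimum of \<open>A\<close> and dividing by \<open>q\<close> embeds
  \<open>A\<close> into the integers from 0 to \<open>L / q\<close>. The bound on the differences,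
  used in both orders, also yields finiteness.\<close>

lemma card_congruent_le:
  fixes A :: "int set" and q :: int
  assumes "q > 0"
    and cong: "\<And>x y. x \<in> A \<Longrightarrow> y \<in> A \<Longrightarrow> q dvd x - y"
    and diff: "\<And>x y. x \<in> A \<Longrightarrow> y \<in> A \<Longrightarrow> real_of_int (x - y) \<le> L"
    and "L \<ge> 0"
  shows "finite A" "real (card A) \<le> L / q + 1"
proof -
  have main: "finite A \<and> real (card A) \<le> L / q + 1"
  proof (cases "A = {}")
    case False
    then obtain b where b: "b \<in> A" by blast
    have "A \<subseteq> {b - \<lfloor>L\<rfloor>..b + \<lfloor>L\<rfloor>}"
    proof
      fix x assume "x \<in> A"
      then show "x \<in> {b - \<lfloor>L\<rfloor>..b + \<lfloor>L\<rfloor>}"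
        using diff[of x b] diff[of b x] b by (auto simp: le_floor_iff) linarith+
    qed
    then have fin: "finite A" using finite_subset by blast
    define a where "a = Min A"
    have a: "a \<in> A" "\<And>x. x \<in> A \<Longrightarrow> a \<le> x" using fin False by (auto simp: a_def)
    have inj: "inj_on (\<lambda>x. (x - a) div q) A"
    proof (rule inj_onI)
      fix x y assume "x \<in> A" "y \<in> A" "(x - a) div q = (y - a) div q"
      moreover from this have "q dvd x - a" "q dvd y - a" using cong a by auto
      ultimately show "x = y" using assms(1) by (metis diff_add_cancel dvd_div_mult_self)
    qed
    have "(\<lambda>x. (x - a) div q) ` A \<subseteq> {0..\<lfloor>L / q\<rfloor>}"
    proof
      fix k assume "k \<in> (\<lambda>x. (x - a) div q) ` A"
      then obtain x where x: "x \<in> A" "k = (x - a) div q" by blast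
      then have "q dvd x - a" using cong a by blast
      then have "x - a = k * q" using x by simp
      then have "real_of_int k * q \<le> L" using diff[OF x(1) a(1)] by (metis of_int_mult)
      moreover have "k \<ge> 0" using a x assms(1) by (simp add: pos_imp_zdiv_nonneg_iff)
      ultimately show "k \<in> {0..\<lfloor>L / q\<rfloor>}" using assms(1) by (simp add: le_floor_iff field_simps)
    qed
    then have "card A \<le> card {0..\<lfloor>L / q\<rfloor>}"
      using inj by (metis card_image card_mono finite_atLeastAtMost_int)
    also have "real \<dots> \<le> L / q + 1" using assms by simp
    finally show ?thesis using fin by simp
  qed (use assms in auto)
  then show "finite A" "real (card A) \<le> L / q + 1" by auto
qed

text \<open>Dividing out \<open>gcd b g\<close> leaves an invertible coefficient, so the solutions
  lie in a single residue class modulo \<open>g' = g div gcd b g\<close>.\<close>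

lemma card_linear_congruence_le:
  fixes b m g q :: int
  assumes "g > 0" "q > 0" "g dvd q"
  shows "int (card {z \<in> {0..<q}. g dvd b * z + m}) \<le> (q div g) * gcd b g"
proof -
  define g' where "g' = g div gcd b g"
  have gg: "g = g' * gcd b g" by (simp add: g'_def)
  then have g': "g' > 0" using assms
    by (metis gcd_ge_0_int less_eq_int_code(1) linorder_not_less mult_nonpos_nonneg)
  have gcd0: "gcd b g > 0" using assms by simp
  obtain k where k: "q = g * k" using assms by blast
  have k0: "k > 0" using k assms by (simp add: zero_less_mult_iff)
  let ?A = "{z \<in> {0..<q}. g dvd b * z + m}"
  \<comment> \<open>Two elements of \<open>{0..<q}\<close> differ by at most \<open>q - 1\<close>;
    this makes the next estimate strict, and integrality then removes the summand 1.\<close>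
  have "real (card ?A) \<le> real_of_int (q - 1) / g' + 1"
  proof (rule card_congruent_le(2)[OF g'])
    fix x y assume "x \<in> ?A" "y \<in> ?A"
    then have "g dvd (b * x + m) - (b * y + m)" by (intro dvd_diff) auto
    then have "g dvd b * (x - y)" by (simp add: algebra_simps)
    moreover have "coprime (b div gcd b g) g'"
      unfolding g'_def using assms by (intro div_gcd_coprime) auto
    moreover have "b * (x - y) = gcd b g * ((b div gcd b g) * (x - y))"
      by (metis dvd_mult_div_cancel gcd_dvd1 mult.assoc)
    ultimately show "g' dvd x - y"
      using gcd0 gg
      by (metis coprime_commute coprime_dvd_mult_right_iff dvd_mult_cancel_left less_irrefl mult.commute)
  next
    fix x y assume "x \<in> ?A" "y \<in> ?A"
    then show "real_of_int (x - y) \<le> real_of_int (q - 1)" by auto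
  qed (use assms in auto)
  also have "\<dots> < real_of_int (k * gcd b g) + 1"
  proof -
    have "real_of_int q = g' * (k * gcd b g)" using k gg by (metis mult.assoc mult.commute of_int_mult)
    then show ?thesis using g' by (simp add: field_simps)
  qed
  finally have "card ?A < k * gcd b g + 1" by linarith
  then show ?thesis using k assms by simp
qed

lemma card_Sigma_le:
  assumes "finite A" "\<And>x. x \<in> A \<Longrightarrow> real (card (B x)) \<le> k" "k \<ge> 0"
    "\<And>x. x \<in> A \<Longrightarrow> finite (B x)"
  shows "real (card (SIGMA x:A. B x)) \<le> real (card A) * k"
proof -
  have "real (card (SIGMA x:A. B x)) = (\<Sum>x\<in>A. real (card (B x)))"
    using assms by (subst card_SigmaI) auto
  also have "\<dots> \<le> real (card A) * k" using assms by (intro sum_bounded_above) auto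
  finally show ?thesis .
qed

text \<open>Solvability in \<open>v\<close> forces \<open>g = gcd b q\<close> to divide
  \<open>b' * z + m\<close>, which leaves at most \<open>(q div g) * gcd b' g\<close> values of
  \<open>z\<close>; each admits at most \<open>g\<close> values of \<open>v\<close>.\<close>

lemma card_linear_congruence_pair_le:
  fixes b b' m q :: int
  assumes "q > 0"
  shows "int (card {(v, z) \<in> {0..<q} \<times> {0..<q}. q dvd b * v + b' * z + m}) \<le> q * gcd b' (gcd b q)"
proof -
  define g where "g = gcd b q"
  have g: "g > 0" "g dvd q" using assms by (auto simp: g_def)
  define Z where "Z = {z \<in> {0..<q}. g dvd b' * z + m}"
  have "{(v, z) \<in> {0..<q} \<times> {0..<q}. q dvd b * v + b' * z + m}
        \<subseteq> prod.swap ` (SIGMA z:Z. {v \<in> {0..<q}. q dvd b * v + (b' * z + m)})" (is "?L \<subseteq> _ ` ?R")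
  proof
    fix p assume "p \<in> ?L"
    then obtain v z where p: "p = (v, z)" "v \<in> {0..<q}" "z \<in> {0..<q}" "q dvd b * v + (b' * z + m)"
      by (auto simp: add.assoc)
    have "g dvd b * v + (b' * z + m)" using p(4) g dvd_trans by blast
    then have "g dvd b' * z + m" by (simp add: g_def dvd_add_right_iff)
    then show "p \<in> prod.swap ` ?R" using p by (auto simp: Z_def intro!: image_eqI[of _ _ "(z, v)"])
  qed
  then have "card ?L \<le> card ?R"
    by (rule surj_card_le[rotated])
      (rule finite_subset[of _ "{0..<q} \<times> {0..<q}"], auto simp: Z_def)
  also have "card ?R = (\<Sum>z\<in>Z. card {v \<in> {0..<q}. q dvd b * v + (b' * z + m)})"
    by (intro card_SigmaI ballI; rule finite_subset[of _ "{0..<q}"]) (auto simp: Z_def)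
  also have "int \<dots> \<le> (\<Sum>z\<in>Z. g)"
    unfolding of_nat_sum
    using card_linear_congruence_le[OF assms assms] assms by (intro sum_mono) (auto simp: g_def)
  also have "\<dots> = int (card Z) * g" by simp
  also have "\<dots> \<le> (q div g) * gcd b' g * g"
    using card_linear_congruence_le[OF g(1) assms g(2)] g unfolding Z_def
    by (intro mult_right_mono) auto
  also have "\<dots> = q * gcd b' g" using g by (simp add: mult.commute mult.left_commute)
  finally show ?thesis by (simp add: g_def)
qed

subsection \<open>Congruence of two values modulo \<open>q\<close>\<close>

text \<open>For positive \<open>q\<close> this is \<open>sigma(q) / q\<close>, with
  \<open>sigma\<close> the sum of divisors. It is the factor that accompanies \<open>q^3\<close> in
  the bound for the number of solutions modulo \<open>q\<close>.\<close>

definition inverse_divisor_sum :: "int \<Rightarrow> real" where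
  "inverse_divisor_sum q = (\<Sum>e \<in> {e \<in> {1..q}. e dvd q}. 1 / real_of_int e)"

text \<open>The smallest positive multiple is \<open>e\<close> itself, so the multiples differ by at
  most \<open>T - e\<close> and no rounding error remains.\<close>

lemma card_multiples_le:
  fixes e T :: int
  assumes "e > 0" "e \<le> T"
  shows "real (card {q \<in> {1..T}. e dvd q}) \<le> T / e"
proof -
  have "real (card {q \<in> {1..T}. e dvd q}) \<le> real_of_int (T - e) / e + 1"
  proof (rule card_congruent_le(2)[OF assms(1)])
    fix x y assume xy: "x \<in> {q \<in> {1..T}. e dvd q}" "y \<in> {q \<in> {1..T}. e dvd q}"
    then have "e \<le> y" by (auto intro: zdvd_imp_le)
    then have "x - y \<le> T - e" using xy by auto
    then show "real_of_int (x - y) \<le> real_of_int (T - e)" by (simp only: of_int_le_iff)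
  qed (use assms in auto)
  also have "\<dots> = T / e" using assms by (simp add: field_simps)
  finally show ?thesis .
qed

text \<open>The summand \<open>- 1 / real n\<close> makes the induction telescope, through
  \<open>1 / (n + 1)^2 \<le> 1 / n - 1 / (n + 1)\<close>. At \<open>n = 0\<close> the convention
  \<open>1 / 0 = 0\<close> applies.\<close>

lemma sum_inverse_squares_le:
  "(\<Sum>e = 1..n. 1 / (real e)\<^sup>2) \<le> 2 - 1 / real n" for n :: nat
proof (induction n)
  case (Suc n)
  show ?case
  proof (cases "n = 0")
    case False
    then have "1 / (real (Suc n))\<^sup>2 \<le> 1 / real n - 1 / real (Suc n)"
      by (simp add: divide_simps) (simp add: power2_eq_square algebra_simps)
    then show ?thesis using Suc by simp
  qed simp
qed simp

text \<open>After exchanging the sums, each \<open>e\<close> contributes \<open>1 / e\<close> for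
  each of its at most \<open>T / e\<close> multiples, and the inverse squares sum to at most 2. So
  \<open>inverse_divisor_sum\<close> is bounded on average, though not pointwise.\<close>

lemma sum_inverse_divisor_sum_le:
  fixes T :: int
  assumes "T \<ge> 0"
  shows "(\<Sum>q = 1..T. inverse_divisor_sum q) \<le> 2 * T"
proof -
  have "(\<Sum>q = 1..T. inverse_divisor_sum q) = (\<Sum>q = 1..T. \<Sum>e | e \<in> {1..T} \<and> e dvd q. 1 / real_of_int e)"
    unfolding inverse_divisor_sum_def
    by (intro sum.cong refl) (auto dest: zdvd_imp_le)
  also have "\<dots> = (\<Sum>e = 1..T. \<Sum>q | q \<in> {1..T} \<and> e dvd q. 1 / real_of_int e)"
    by (rule sum.swap_restrict) auto
  also have "\<dots> = (\<Sum>e = 1..T. real (card {q \<in> {1..T}. e dvd q}) * (1 / e))"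
    by simp
  also have "\<dots> \<le> (\<Sum>e = 1..T. T / e * (1 / e))"
    by (intro sum_mono mult_right_mono card_multiples_le) auto
  also have "\<dots> = T * (\<Sum>e = 1..T. 1 / (real_of_int e)\<^sup>2)"
    by (simp add: sum_distrib_left power2_eq_square)
  finally have *: "(\<Sum>q = 1..T. inverse_divisor_sum q) \<le> T * (\<Sum>e = 1..T. 1 / (real_of_int e)\<^sup>2)" .
  have "(\<Sum>e = 1..T. 1 / (real_of_int e)\<^sup>2) = (\<Sum>e = 1..nat T. 1 / (real e)\<^sup>2)"
    by (rule sum.reindex_bij_witness[of _ int nat]) auto
  also have "\<dots> \<le> 2"
    using sum_inverse_squares_le[of "nat T"] by (smt (verit) divide_nonneg_nonneg of_nat_0_le_iff)
  finally have "T * (\<Sum>e = 1..T. 1 / (real_of_int e)\<^sup>2) \<le> T * (2 :: real)"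
    using assms by (intro mult_left_mono) auto
  with * show ?thesis by simp
qed

text \<open>\<open>card_linear_congruence_pair_le\<close> produces this gcd for the coefficients
  \<open>2 * u\<close> and \<open>- (2 * a * w)\<close>. It divides \<open>2 * a * w\<close>,
  \<open>2 * a * u\<close> and \<open>2 * a * q\<close>, whose gcd is the right-hand side.\<close>

lemma gcd_scaled_le:
  fixes a u w q :: int
  assumes "a \<noteq> 0" "q > 0"
  shows "gcd (- (2 * a * w)) (gcd (2 * u) q) \<le> 2 * \<bar>a\<bar> * gcd w (gcd u q)"
proof (rule zdvd_imp_le)
  have "gcd (- (2 * a * w)) (gcd (2 * u) q) dvd gcd (2 * a * w) (gcd (2 * a * u) (2 * a * q))"
  proof (intro gcd_greatest)
    let ?g = "gcd (- (2 * a * w)) (gcd (2 * u) q)"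
    show "?g dvd 2 * a * w" by (metis gcd_dvd1 gcd_neg1_int)
    have "?g dvd 2 * u" by (meson dvd_trans gcd_dvd1 gcd_dvd2)
    then show "?g dvd 2 * a * u" by (metis dvd_mult mult.assoc mult.commute)
    have "?g dvd q" by (meson dvd_trans gcd_dvd2)
    then show "?g dvd 2 * a * q" by simp
  qed
  also have "gcd (2 * a * w) (gcd (2 * a * u) (2 * a * q)) = 2 * \<bar>a\<bar> * gcd w (gcd u q)"
  proof -
    have "gcd (2 * a * u) (2 * a * q) = 2 * \<bar>a\<bar> * gcd u q"
      by (simp add: gcd_mult_left abs_mult)
    then have "gcd (2 * a * w) (gcd (2 * a * u) (2 * a * q)) = gcd (2 * \<bar>a\<bar> * w) (2 * \<bar>a\<bar> * gcd u q)"
      by (metis abs_mult abs_numeral gcd_abs1_int abs_abs abs_idempotent)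
    then show ?thesis by (simp add: gcd_mult_left abs_mult)
  qed
  finally show "gcd (- (2 * a * w)) (gcd (2 * u) q) dvd 2 * \<bar>a\<bar> * gcd w (gcd u q)" .
  show "0 < 2 * \<bar>a\<bar> * gcd w (gcd u q)" using assms by simp
qed

text \<open>A gcd is one of the common divisors, so it is at most their sum. Each divisor
  \<open>e\<close> of \<open>q\<close> divides \<open>q / e\<close> of the residues \<open>u\<close>
  and as many of the \<open>w\<close>, contributing \<open>e * (q / e)^2 = q^2 / e\<close>.\<close>

lemma sum_gcd_le:
  fixes q :: int
  assumes "q > 0"
  shows "(\<Sum>u = 0..<q. \<Sum>w = 0..<q. real_of_int (gcd w (gcd u q))) \<le> q\<^sup>2 * inverse_divisor_sum q"
proof -
  define D where "D = {e \<in> {1..q}. e dvd q}"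
  have D: "finite D" by (rule finite_subset[of _ "{1..q}"]) (auto simp: D_def)
  have "real_of_int (gcd w (gcd u q)) \<le> (\<Sum>e\<in>D. of_bool (e dvd u) * of_bool (e dvd w) * real_of_int e)" for u w
  proof -
    define g where "g = gcd w (gcd u q)"
    have g: "g dvd w" "g dvd u" "g dvd q" "g > 0"
      using assms unfolding g_def by (auto intro: dvd_trans[OF gcd_dvd2])
    have "g \<in> D" using g assms by (auto simp: D_def intro: zdvd_imp_le)
    have "real_of_int g = (\<Sum>e\<in>{g}. of_bool (e dvd u) * of_bool (e dvd w) * real_of_int e)"
      using g by simp
    also have "\<dots> \<le> (\<Sum>e\<in>D. of_bool (e dvd u) * of_bool (e dvd w) * real_of_int e)"
      using \<open>g \<in> D\<close> D by (intro sum_mono2) (auto simp: D_def)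
    finally show ?thesis by (simp add: g_def)
  qed
  then have "(\<Sum>u = 0..<q. \<Sum>w = 0..<q. real_of_int (gcd w (gcd u q))) \<le>
      (\<Sum>u = 0..<q. \<Sum>w = 0..<q. \<Sum>e\<in>D. of_bool (e dvd u) * of_bool (e dvd w) * real_of_int e)"
    by (intro sum_mono) auto
  also have "\<dots> = (\<Sum>u = 0..<q. \<Sum>e\<in>D. \<Sum>w = 0..<q. of_bool (e dvd u) * of_bool (e dvd w) * real_of_int e)"
    by (intro sum.cong refl sum.swap)
  also have "\<dots> = (\<Sum>e\<in>D. \<Sum>u = 0..<q. \<Sum>w = 0..<q. of_bool (e dvd u) * of_bool (e dvd w) * real_of_int e)"
    by (rule sum.swap)
  also have "\<dots> = (\<Sum>e\<in>D. (\<Sum>u = 0..<q. of_bool (e dvd u)) * (\<Sum>w = 0..<q. of_bool (e dvd w)) * real_of_int e)"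
    by (intro sum.cong refl) (subst sum_product, simp only: sum_distrib_right)
  also have "\<dots> \<le> (\<Sum>e\<in>D. (q / e) * (q / e) * real_of_int e)"
  proof (intro sum_mono)
    fix e assume e: "e \<in> D"
    have "(\<Sum>u = 0..<q. of_bool (e dvd u) :: real) = real (card {u \<in> {0..<q}. e dvd 1 * u + 0})"
      by (simp add: Int_def)
    also have "\<dots> \<le> real_of_int (q div e * gcd 1 e)"
      using card_linear_congruence_le[of e q 1 0] e assms
      by (metis (no_types, lifting) D_def atLeastAtMost_iff mem_Collect_eq of_int_le_iff of_int_of_nat_eq zero_less_one order_less_le_trans)
    also have "\<dots> = q / e" using e by (auto simp: D_def real_of_int_div)
    finally have *: "(\<Sum>u = 0..<q. of_bool (e dvd u) :: real) \<le> q / e" .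
    have "e > 0" using e by (auto simp: D_def)
    then show "(\<Sum>u = 0..<q. of_bool (e dvd u)) * (\<Sum>w = 0..<q. of_bool (e dvd w)) * real_of_int e
        \<le> (q / e) * (q / e) * real_of_int e"
      using assms * by (intro mult_right_mono mult_mono) (auto intro!: sum_nonneg)
  qed
  also have "\<dots> = (\<Sum>e\<in>D. q\<^sup>2 * (1 / real_of_int e))"
    by (intro sum.cong) (auto simp: D_def power2_eq_square)
  also have "\<dots> = q\<^sup>2 * inverse_divisor_sum q"
    by (simp only: inverse_divisor_sum_def D_def sum_distrib_left)
  finally show ?thesis by simp
qed

definition residue_quadruples :: "int \<Rightarrow> int \<Rightarrow> (int \<times> int \<times> int \<times> int) set" where
  "residue_quadruples a q = {(x\<^sub>1, y\<^sub>1, x\<^sub>2, y\<^sub>2).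
     x\<^sub>1 \<in> {0..<q} \<and> y\<^sub>1 \<in> {0..<q} \<and> x\<^sub>2 \<in> {0..<q} \<and> y\<^sub>2 \<in> {0..<q} \<and>
     q dvd (x\<^sub>1\<^sup>2 - a * y\<^sub>1\<^sup>2) - (x\<^sub>2\<^sup>2 - a * y\<^sub>2\<^sup>2)}"

lemma finite_residue_quadruples: "finite (residue_quadruples a q)"
  by (rule finite_subset[of _ "{0..<q} \<times> {0..<q} \<times> {0..<q} \<times> {0..<q}"])
    (auto simp: residue_quadruples_def)

text \<open>For fixed differences \<open>x\<^sub>1 - x\<^sub>2\<close> and \<open>y\<^sub>1 - y\<^sub>2\<close> the congruence is linear in \<open>x\<^sub>2\<close> and \<open>y\<^sub>2\<close>.\<close>

lemma card_residue_quadruples_le: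
  fixes a q :: int
  assumes "a \<noteq> 0" "q > 0"
  shows "real (card (residue_quadruples a q)) \<le> 2 * \<bar>a\<bar> * q ^ 3 * inverse_divisor_sum q"
proof -
  let ?R = "{0..<q}"
  \<comment> \<open>\<open>V (u, w)\<close> collects the pairs \<open>(x\<^sub>2, y\<^sub>2)\<close>
    for which \<open>x\<^sub>1 = x\<^sub>2 + u\<close> and \<open>y\<^sub>1 = y\<^sub>2 + w\<close>
    solve the congruence; the squares of \<open>x\<^sub>2\<close> and \<open>y\<^sub>2\<close>
    cancel.\<close>
  define V where "V = (\<lambda>(u, w). {(x, y) \<in> ?R \<times> ?R.
      q dvd (2 * u) * x + (- (2 * a * w)) * y + (u\<^sup>2 - a * w\<^sup>2)})"
  define f where "f = (\<lambda>(x\<^sub>1 :: int, y\<^sub>1 :: int, x\<^sub>2, y\<^sub>2). (((x\<^sub>1 - x\<^sub>2) mod q, (y\<^sub>1 - y\<^sub>2) mod q), (x\<^sub>2, y\<^sub>2)))"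
  have finV: "finite (V p)" for p
    by (rule finite_subset[of _ "?R \<times> ?R"]) (auto simp: V_def)
  have "card (residue_quadruples a q) \<le> card (SIGMA p:?R \<times> ?R. V p)"
  proof (rule card_inj_on_le)
    have eq: "x = x'" if "(x - z) mod q = (x' - z) mod q" "x \<in> ?R" "x' \<in> ?R" for x x' z :: int
    proof -
      have "q dvd (x - z) - (x' - z)" using that(1) mod_eq_dvd_iff by blast
      then have "x mod q = x' mod q" by (simp add: mod_eq_dvd_iff)
      then show ?thesis using that by simp
    qed
    show "inj_on f (residue_quadruples a q)"
      by (rule inj_onI) (auto simp: f_def residue_quadruples_def dest: eq)
    show "f ` residue_quadruples a q \<subseteq> (SIGMA p:?R \<times> ?R. V p)"
    proof
      fix r assume "r \<in> f ` residue_quadruples a q"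
      then obtain x\<^sub>1 y\<^sub>1 x\<^sub>2 y\<^sub>2 where r: "r = f (x\<^sub>1, y\<^sub>1, x\<^sub>2, y\<^sub>2)" "x\<^sub>2 \<in> ?R" "y\<^sub>2 \<in> ?R"
        "q dvd (x\<^sub>1\<^sup>2 - a * y\<^sub>1\<^sup>2) - (x\<^sub>2\<^sup>2 - a * y\<^sub>2\<^sup>2)" by (auto simp: residue_quadruples_def)
      define u w where "u = (x\<^sub>1 - x\<^sub>2) mod q" and "w = (y\<^sub>1 - y\<^sub>2) mod q"
      define k l where "k = (x\<^sub>1 - x\<^sub>2) div q" and "l = (y\<^sub>1 - y\<^sub>2) div q"
      have x1: "x\<^sub>1 = x\<^sub>2 + u + q * k" and y1: "y\<^sub>1 = y\<^sub>2 + w + q * l"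
        unfolding u_def w_def k_def l_def by (simp_all add: algebra_simps)
      \<comment> \<open>\<open>x\<^sub>1 - x\<^sub>2\<close> and
        \<open>y\<^sub>1 - y\<^sub>2\<close> agree with \<open>u\<close> and \<open>w\<close> only
        up to multiples of \<open>q\<close>; the last summand collects these corrections.\<close>
      have "(x\<^sub>1\<^sup>2 - a * y\<^sub>1\<^sup>2) - (x\<^sub>2\<^sup>2 - a * y\<^sub>2\<^sup>2) =
         ((2 * u) * x\<^sub>2 + (- (2 * a * w)) * y\<^sub>2 + (u\<^sup>2 - a * w\<^sup>2)) +
         q * (k * (2 * (x\<^sub>2 + u) + q * k) - a * l * (2 * (y\<^sub>2 + w) + q * l))"
        unfolding x1 y1 by (simp add: power2_eq_square algebra_simps)
      with r(4) have "q dvd (2 * u) * x\<^sub>2 + (- (2 * a * w)) * y\<^sub>2 + (u\<^sup>2 - a * w\<^sup>2)"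
        by (metis dvd_add_left_iff dvd_triv_left)
      then show "r \<in> (SIGMA p:?R \<times> ?R. V p)"
        using r assms by (auto simp: f_def V_def u_def w_def)
    qed
    show "finite (SIGMA p:?R \<times> ?R. V p)" using finV by (intro finite_SigmaI) auto
  qed
  also have "card (SIGMA p:?R \<times> ?R. V p) = (\<Sum>p\<in>?R \<times> ?R. card (V p))"
    using finV by (intro card_SigmaI) auto
  finally have "real (card (residue_quadruples a q)) \<le> (\<Sum>p\<in>?R \<times> ?R. real (card (V p)))"
    by (metis of_nat_le_iff of_nat_sum)
  also have "\<dots> = (\<Sum>u\<in>?R. \<Sum>w\<in>?R. real (card (V (u, w))))"
    by (simp add: sum.cartesian_product)
  also have "\<dots> \<le> (\<Sum>u\<in>?R. \<Sum>w\<in>?R. 2 * \<bar>a\<bar> * q * real_of_int (gcd w (gcd u q)))"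
  proof (intro sum_mono)
    fix u w
    have "int (card (V (u, w))) \<le> q * gcd (- (2 * a * w)) (gcd (2 * u) q)"
      unfolding V_def prod.case by (rule card_linear_congruence_pair_le[OF assms(2)])
    also have "\<dots> \<le> q * (2 * \<bar>a\<bar> * gcd w (gcd u q))"
      using gcd_scaled_le[OF assms] assms by (intro mult_left_mono) auto
    finally have "real_of_int (int (card (V (u, w)))) \<le> real_of_int (q * (2 * \<bar>a\<bar> * gcd w (gcd u q)))"
      by (simp only: of_int_le_iff)
    then show "real (card (V (u, w))) \<le> 2 * \<bar>a\<bar> * q * real_of_int (gcd w (gcd u q))"
      by (simp add: mult_ac)
  qed
  also have "\<dots> = 2 * \<bar>a\<bar> * q * (\<Sum>u\<in>?R. \<Sum>w\<in>?R. real_of_int (gcd w (gcd u q)))"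
    by (simp add: sum_distrib_left)
  also have "\<dots> \<le> 2 * \<bar>a\<bar> * q * (q\<^sup>2 * inverse_divisor_sum q)"
    using sum_gcd_le[OF assms(2)] assms by (intro mult_left_mono) auto
  finally show ?thesis by (simp add: power2_eq_square power3_eq_cube mult_ac)
qed

subsection \<open>Equality of two values\<close>

lemma card_nonzero_abs_le: "card {x :: int. x \<noteq> 0 \<and> \<bar>x\<bar> \<le> n} = nat (2 * n)" if "n \<ge> 0"
proof -
  have "{x :: int. x \<noteq> 0 \<and> \<bar>x\<bar> \<le> n} = {-n..n} - {0}" by auto
  then show ?thesis using that by (simp add: card_Diff_singleton_if)
qed

lemma finite_nonzero_abs_le: "finite {x :: int. x \<noteq> 0 \<and> \<bar>x\<bar> \<le> n}"
  by (rule finite_subset[of _ "{-n..n}"]) auto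

lemma sum_inverse_abs_le:
  fixes B :: int
  assumes "B \<ge> 1"
  shows "(\<Sum>m | m \<noteq> 0 \<and> \<bar>m\<bar> \<le> B. 1 / real_of_int \<bar>m\<bar>) \<le> 2 * (1 + ln B)"
proof -
  have eq: "{m. m \<noteq> 0 \<and> \<bar>m\<bar> \<le> B} = {1..B} \<union> {-B..-1}" by auto
  have "(\<Sum>m | m \<noteq> 0 \<and> \<bar>m\<bar> \<le> B. 1 / real_of_int \<bar>m\<bar>) =
      (\<Sum>m\<in>{1..B}. 1 / real_of_int \<bar>m\<bar>) + (\<Sum>m\<in>{-B..-1}. 1 / real_of_int \<bar>m\<bar>)"
    unfolding eq by (rule sum.union_disjoint) auto
  also have "(\<Sum>m\<in>{-B..-1}. 1 / real_of_int \<bar>m\<bar>) = (\<Sum>m\<in>{1..B}. 1 / real_of_int \<bar>m\<bar>)"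
    by (rule sum.reindex_bij_witness[of _ uminus uminus]) auto
  also have "(\<Sum>m\<in>{1..B}. 1 / real_of_int \<bar>m\<bar>) = harm (nat B)"
    unfolding harm_def
    by (rule sum.reindex_bij_witness[of _ int nat]) (auto simp: divide_inverse)
  \<comment> \<open>The sequence \<open>harm n - ln n\<close> decreases and equals 1 at
    \<open>n = 1\<close>.\<close>
  also have "harm (nat B) \<le> (1 + ln B :: real)"
    using euler_mascheroni_sequence_decreasing[of 1 "nat B"] assms
    by (simp add: harm_expand Suc_le_eq)
  finally show ?thesis by simp
qed

text \<open>For fixed \<open>m\<close> there are \<open>2 * |m|\<close> choices of \<open>l\<close>
  and at most \<open>2 * B / |m|\<close> of each of \<open>g\<close> and \<open>k\<close>, hence at
  most \<open>8 * B^2 / |m|\<close> triples; summing over \<open>m\<close> produces the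
  logarithm.\<close>

lemma card_dominated_quadruples_le:
  fixes B :: int
  assumes "B \<ge> 1"
  defines "V \<equiv> {(m, l, g, k). m \<noteq> 0 \<and> l \<noteq> 0 \<and> g \<noteq> 0 \<and> k \<noteq> 0 \<and>
    \<bar>l\<bar> \<le> \<bar>m\<bar> \<and> \<bar>g * m\<bar> \<le> B \<and> \<bar>k * m\<bar> \<le> B}"
  shows "finite V" "real (card V) \<le> 16 * B\<^sup>2 * (1 + ln B)"
proof -
  define N where "N = (\<lambda>n :: int. {x :: int. x \<noteq> 0 \<and> \<bar>x\<bar> \<le> n})"
  define W where "W = (SIGMA m:N B. N \<bar>m\<bar> \<times> N (B div \<bar>m\<bar>) \<times> N (B div \<bar>m\<bar>))"
  have div: "\<bar>g\<bar> \<le> B div \<bar>m\<bar>" if "\<bar>g * m\<bar> \<le> B" "m \<noteq> 0" for g m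
  proof -
    have "\<bar>g\<bar> = (\<bar>g\<bar> * \<bar>m\<bar>) div \<bar>m\<bar>" using that by simp
    also have "\<dots> \<le> B div \<bar>m\<bar>" using that by (intro zdiv_mono1) (auto simp: abs_mult)
    finally show ?thesis .
  qed
  have "V \<subseteq> W"
  proof
    fix p assume "p \<in> V"
    then obtain m l g k where p: "p = (m, l, g, k)" "m \<noteq> 0" "l \<noteq> 0" "g \<noteq> 0" "k \<noteq> 0"
      "\<bar>l\<bar> \<le> \<bar>m\<bar>" "\<bar>g * m\<bar> \<le> B" "\<bar>k * m\<bar> \<le> B" by (auto simp: V_def)
    have "1 * \<bar>m\<bar> \<le> \<bar>g\<bar> * \<bar>m\<bar>" using p by (intro mult_right_mono) auto
    then have "\<bar>m\<bar> \<le> B" using p(7)[unfolded abs_mult] by linarith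
    then show "p \<in> W" using p(2-6) div[OF p(7,2)] div[OF p(8,2)] unfolding p(1) W_def N_def by simp
  qed
  moreover have finW: "finite W"
    unfolding W_def N_def by (intro finite_SigmaI finite_cartesian_product finite_nonzero_abs_le)
  ultimately show "finite V" by (rule finite_subset)
  have "card V \<le> card W" using finW \<open>V \<subseteq> W\<close> by (rule card_mono)
  also have "card W = (\<Sum>m\<in>N B. card (N \<bar>m\<bar>) * (card (N (B div \<bar>m\<bar>)) * card (N (B div \<bar>m\<bar>))))"
    unfolding W_def N_def
    by (subst card_SigmaI) (auto simp: finite_nonzero_abs_le card_cartesian_product)
  also have "real \<dots> \<le> (\<Sum>m\<in>N B. 8 * B\<^sup>2 * (1 / real_of_int \<bar>m\<bar>))"
    unfolding of_nat_sum
  proof (rule sum_mono)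
    fix m assume "m \<in> N B"
    then have m: "\<bar>m\<bar> > 0" "\<bar>m\<bar> \<le> B" by (auto simp: N_def)
    have 1: "real (card (N \<bar>m\<bar>)) = 2 * real_of_int \<bar>m\<bar>"
      unfolding N_def by (subst card_nonzero_abs_le) auto
    have "real (card (N (B div \<bar>m\<bar>))) = 2 * real_of_int (B div \<bar>m\<bar>)"
      unfolding N_def using m assms
      by (subst card_nonzero_abs_le) (auto simp: pos_imp_zdiv_nonneg_iff)
    also have "\<dots> \<le> 2 * (B / real_of_int \<bar>m\<bar>)"
      using real_of_int_div4[of B "\<bar>m\<bar>"] by simp
    finally have 2: "real (card (N (B div \<bar>m\<bar>))) \<le> 2 * (B / real_of_int \<bar>m\<bar>)" .
    have "real (card (N \<bar>m\<bar>) * (card (N (B div \<bar>m\<bar>)) * card (N (B div \<bar>m\<bar>))))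
       \<le> (2 * real_of_int \<bar>m\<bar>) * ((2 * (B / real_of_int \<bar>m\<bar>)) * (2 * (B / real_of_int \<bar>m\<bar>)))"
      unfolding of_nat_mult 1 using 2 assms m by (intro mult_left_mono mult_mono) auto
    also have "\<dots> = 8 * B\<^sup>2 * (1 / real_of_int \<bar>m\<bar>)"
      using m by (simp add: power2_eq_square divide_simps)
    finally show "real (card (N \<bar>m\<bar>) * (card (N (B div \<bar>m\<bar>)) * card (N (B div \<bar>m\<bar>)))) \<le>
      8 * B\<^sup>2 * (1 / real_of_int \<bar>m\<bar>)" by simp
  qed
  also have "\<dots> = 8 * B\<^sup>2 * (\<Sum>m\<in>N B. 1 / real_of_int \<bar>m\<bar>)"
    by (simp add: sum_distrib_left)
  also have "\<dots> \<le> 8 * B\<^sup>2 * (2 * (1 + ln B))"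
    using sum_inverse_abs_le[OF assms(1)] unfolding N_def by (intro mult_left_mono) auto
  finally show "real (card V) \<le> 16 * B\<^sup>2 * (1 + ln B)" by (simp add: algebra_simps)
qed

definition equal_value_quadruples :: "int \<Rightarrow> int \<Rightarrow> (int \<times> int \<times> int \<times> int) set" where
  "equal_value_quadruples a S = {(x\<^sub>1, y\<^sub>1, x\<^sub>2, y\<^sub>2).
     x\<^sub>1 \<in> {1..S} \<and> y\<^sub>1 \<in> {1..S} \<and> x\<^sub>2 \<in> {1..S} \<and> y\<^sub>2 \<in> {1..S} \<and>
     x\<^sub>1\<^sup>2 - a * y\<^sub>1\<^sup>2 = x\<^sub>2\<^sup>2 - a * y\<^sub>2\<^sup>2}"

lemma finite_equal_value_quadruples: "finite (equal_value_quadruples a S)"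
  by (rule finite_subset[of _ "{1..S} \<times> {1..S} \<times> {1..S} \<times> {1..S}"])
    (auto simp: equal_value_quadruples_def)

text \<open>The equation factors as \<open>(x\<^sub>1 - x\<^sub>2) (x\<^sub>1 + x\<^sub>2) = a (y\<^sub>1 - y\<^sub>2) (y\<^sub>1 + y\<^sub>2)\<close>. A solution with
  nonzero factors is parametrised by \<open>x\<^sub>1 - x\<^sub>2 = g u\<close>, \<open>y\<^sub>1 - y\<^sub>2 = g w\<close>, \<open>x\<^sub>1 + x\<^sub>2 = w k\<close>,
  \<open>a (y\<^sub>1 + y\<^sub>2) = u k\<close> with \<open>u\<close>, \<open>w\<close> coprime.\<close>

lemma card_equal_value_quadruples_le:
  fixes a S :: int
  assumes "a \<noteq> 0" "S \<ge> 1"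
  shows "real (card (equal_value_quadruples a S))
    \<le> S\<^sup>2 + 128 * a\<^sup>2 * S\<^sup>2 * (1 + ln (2 * \<bar>a\<bar> * S))"
proof -
  \<comment> \<open>This bounds all four products \<open>g * u\<close>, \<open>g * w\<close>,
    \<open>k * w\<close> and \<open>k * u\<close> of the parametrisation.\<close>
  define B where "B = 2 * \<bar>a\<bar> * S"
  have "1 * S \<le> \<bar>a\<bar> * S" using assms by (intro mult_right_mono) auto
  then have B: "B \<ge> 1" "2 * S \<le> B" using assms(2) unfolding B_def by linarith+
  define V where "V = {(m, l, g, k). m \<noteq> 0 \<and> l \<noteq> 0 \<and> g \<noteq> 0 \<and> k \<noteq> 0 \<and>
    \<bar>l\<bar> \<le> \<bar>m\<bar> \<and> \<bar>g * m\<bar> \<le> B \<and> \<bar>k * m\<bar> \<le> B}"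
  have V: "finite V" "real (card V) \<le> 16 * B\<^sup>2 * (1 + ln B)"
    unfolding V_def using card_dominated_quadruples_le[OF B(1)] by auto
  define Z where "Z = {(x\<^sub>1, y\<^sub>1, x\<^sub>2, y\<^sub>2) \<in> equal_value_quadruples a S. x\<^sub>1 \<noteq> x\<^sub>2 \<and> y\<^sub>1 \<noteq> y\<^sub>2}"
  \<comment> \<open>For solutions, positivity and \<open>a \<noteq> 0\<close> make
    \<open>x\<^sub>1 = x\<^sub>2\<close> equivalent to \<open>y\<^sub>1 = y\<^sub>2\<close>, so
    those with a zero factor are all diagonal.\<close>
  define D where "D = (\<lambda>(x, y). (x, y, x, y)) ` ({1..S} \<times> {1..S})"
  have "equal_value_quadruples a S \<subseteq> D \<union> Z"
  proof
    fix p assume "p \<in> equal_value_quadruples a S"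
    then obtain x\<^sub>1 y\<^sub>1 x\<^sub>2 y\<^sub>2 where p: "p = (x\<^sub>1, y\<^sub>1, x\<^sub>2, y\<^sub>2)" "p \<in> equal_value_quadruples a S"
       "x\<^sub>1 \<in> {1..S}" "y\<^sub>1 \<in> {1..S}" "x\<^sub>2 \<in> {1..S}" "y\<^sub>2 \<in> {1..S}"
       "x\<^sub>1\<^sup>2 - a * y\<^sub>1\<^sup>2 = x\<^sub>2\<^sup>2 - a * y\<^sub>2\<^sup>2" by (auto simp: equal_value_quadruples_def)
    have "y\<^sub>1 = y\<^sub>2" if "x\<^sub>1 = x\<^sub>2" using p that assms by (auto simp: power2_eq_iff)
    moreover have "x\<^sub>1 = x\<^sub>2" if "y\<^sub>1 = y\<^sub>2" using p that assms by (auto simp: power2_eq_iff)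
    ultimately show "p \<in> D \<union> Z" using p by (cases "x\<^sub>1 = x\<^sub>2") (auto simp: D_def Z_def)
  qed
  moreover have "finite Z" unfolding Z_def
    by (rule finite_subset[OF _ finite_equal_value_quadruples[of a S]]) auto
  moreover have "finite D" by (simp add: D_def)
  ultimately have "card (equal_value_quadruples a S) \<le> card D + card Z"
    by (meson card_Un_le card_mono finite_UnI order_trans)
  moreover have "card D \<le> card ({1..S} \<times> {1..S})" unfolding D_def by (rule card_image_le) simp
  moreover have "card Z \<le> card V + card V"
  proof -
    \<comment> \<open>The larger of \<open>|u|\<close> and \<open>|w|\<close> has to become the
      dominating entry \<open>m\<close> of \<open>V\<close>; \<open>f1\<close> restores the order
      when it is \<open>w\<close>, \<open>f2\<close> when it is \<open>u\<close>. This costs a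
      factor 2.\<close>
    define f1 f2 where "f1 = (\<lambda>(m, l, g, k). (g, l, m, k) :: int \<times> int \<times> int \<times> int)"
      and "f2 = (\<lambda>(m, l, g, k). (g, m, l, k) :: int \<times> int \<times> int \<times> int)"
    define U where "U = f1 ` V \<union> f2 ` V"
    define \<phi> where "\<phi> = (\<lambda>(x\<^sub>1 :: int, y\<^sub>1 :: int, x\<^sub>2, y\<^sub>2). let g = gcd (x\<^sub>1 - x\<^sub>2) (y\<^sub>1 - y\<^sub>2) in
      (g, (x\<^sub>1 - x\<^sub>2) div g, (y\<^sub>1 - y\<^sub>2) div g, (x\<^sub>1 + x\<^sub>2) div ((y\<^sub>1 - y\<^sub>2) div g)))"
    have key: "x\<^sub>1 - x\<^sub>2 = g * u \<and> y\<^sub>1 - y\<^sub>2 = g * w \<and> x\<^sub>1 + x\<^sub>2 = w * k \<and> a * (y\<^sub>1 + y\<^sub>2) = u * k \<and>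
        g \<noteq> 0 \<and> u \<noteq> 0 \<and> w \<noteq> 0 \<and> k \<noteq> 0"
      if p: "(x\<^sub>1, y\<^sub>1, x\<^sub>2, y\<^sub>2) \<in> Z" and \<phi>: "\<phi> (x\<^sub>1, y\<^sub>1, x\<^sub>2, y\<^sub>2) = (g, u, w, k)"
      for x\<^sub>1 y\<^sub>1 x\<^sub>2 y\<^sub>2 g u w k
    proof -
      have g: "g = gcd (x\<^sub>1 - x\<^sub>2) (y\<^sub>1 - y\<^sub>2)" and u: "u = (x\<^sub>1 - x\<^sub>2) div g" and w: "w = (y\<^sub>1 - y\<^sub>2) div g"
        and k: "k = (x\<^sub>1 + x\<^sub>2) div w" using \<phi> by (auto simp: \<phi>_def Let_def)
      have ne: "x\<^sub>1 \<noteq> x\<^sub>2" "y\<^sub>1 \<noteq> y\<^sub>2" and pos: "x\<^sub>1 + x\<^sub>2 \<noteq> 0"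
        and eq: "x\<^sub>1\<^sup>2 - a * y\<^sub>1\<^sup>2 = x\<^sub>2\<^sup>2 - a * y\<^sub>2\<^sup>2"
        using p by (auto simp: Z_def equal_value_quadruples_def)
      have 1: "x\<^sub>1 - x\<^sub>2 = g * u" "y\<^sub>1 - y\<^sub>2 = g * w" unfolding u w g by simp_all
      then have nz: "g \<noteq> 0" "u \<noteq> 0" "w \<noteq> 0" using ne by auto
      have cop: "coprime u w" unfolding u w g using ne by (intro div_gcd_coprime) auto
      have "(x\<^sub>1 - x\<^sub>2) * (x\<^sub>1 + x\<^sub>2) = a * ((y\<^sub>1 - y\<^sub>2) * (y\<^sub>1 + y\<^sub>2))"
        using eq by (simp add: power2_eq_square algebra_simps)
      then have "g * (u * (x\<^sub>1 + x\<^sub>2)) = g * (w * (a * (y\<^sub>1 + y\<^sub>2)))"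
        unfolding 1 by (simp only: mult_ac)
      then have uw: "u * (x\<^sub>1 + x\<^sub>2) = w * (a * (y\<^sub>1 + y\<^sub>2))" using nz by simp
      then have "w dvd u * (x\<^sub>1 + x\<^sub>2)" by simp
      then have "w dvd x\<^sub>1 + x\<^sub>2" using cop by (simp add: coprime_commute coprime_dvd_mult_right_iff)
      then have 2: "x\<^sub>1 + x\<^sub>2 = w * k" unfolding k by simp
      have 3: "a * (y\<^sub>1 + y\<^sub>2) = u * k" using uw nz unfolding 2 by simp
      have "k \<noteq> 0" using 2 pos by auto
      then show ?thesis using 1 2 3 nz by simp
    qed
    have "inj_on \<phi> Z"
    proof (rule inj_onI)
      fix p p' assume pp: "p \<in> Z" "p' \<in> Z" "\<phi> p = \<phi> p'"
      obtain x\<^sub>1 y\<^sub>1 x\<^sub>2 y\<^sub>2 where p: "p = (x\<^sub>1, y\<^sub>1, x\<^sub>2, y\<^sub>2)" by (cases p)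
      obtain x\<^sub>1' y\<^sub>1' x\<^sub>2' y\<^sub>2' where p': "p' = (x\<^sub>1', y\<^sub>1', x\<^sub>2', y\<^sub>2')" by (cases p')
      obtain g u w k where \<phi>: "\<phi> p = (g, u, w, k)" by (cases "\<phi> p")
      note k1 = key[OF pp(1)[unfolded p] \<phi>[unfolded p]]
      note k2 = key[OF pp(2)[unfolded p'] \<phi>[unfolded pp(3) p']]
      have "y\<^sub>1 + y\<^sub>2 = y\<^sub>1' + y\<^sub>2'" using k1 k2 assms by (metis mult_left_cancel)
      moreover have "y\<^sub>1 - y\<^sub>2 = y\<^sub>1' - y\<^sub>2'" "x\<^sub>1 - x\<^sub>2 = x\<^sub>1' - x\<^sub>2'" "x\<^sub>1 + x\<^sub>2 = x\<^sub>1' + x\<^sub>2'"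
        using k1 k2 by auto
      ultimately show "p = p'" unfolding p p' by auto
    qed
    moreover have "\<phi> ` Z \<subseteq> U"
    proof
      fix r assume "r \<in> \<phi> ` Z"
      then obtain x\<^sub>1 y\<^sub>1 x\<^sub>2 y\<^sub>2 where p: "(x\<^sub>1, y\<^sub>1, x\<^sub>2, y\<^sub>2) \<in> Z" "r = \<phi> (x\<^sub>1, y\<^sub>1, x\<^sub>2, y\<^sub>2)" by auto
      obtain g u w k where r: "r = (g, u, w, k)" by (cases r)
      note k = key[OF p(1) p(2)[symmetric, unfolded r]]
      have bd: "x\<^sub>1 \<in> {1..S}" "y\<^sub>1 \<in> {1..S}" "x\<^sub>2 \<in> {1..S}" "y\<^sub>2 \<in> {1..S}"
        using p by (auto simp: Z_def equal_value_quadruples_def)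
      have e: "g * u = x\<^sub>1 - x\<^sub>2" "g * w = y\<^sub>1 - y\<^sub>2" "k * w = x\<^sub>1 + x\<^sub>2" "k * u = a * (y\<^sub>1 + y\<^sub>2)"
        and nz: "g \<noteq> 0" "u \<noteq> 0" "w \<noteq> 0" "k \<noteq> 0"
        using k by (simp_all only: mult.commute simp_thms)
      have "\<bar>g * u\<bar> \<le> B" "\<bar>g * w\<bar> \<le> B" "\<bar>k * w\<bar> \<le> B"
        unfolding e using bd B by auto
      moreover have "\<bar>k * u\<bar> \<le> B"
      proof -
        have "\<bar>k * u\<bar> = \<bar>a\<bar> * (y\<^sub>1 + y\<^sub>2)" unfolding e abs_mult using bd by simp
        also have "\<dots> \<le> \<bar>a\<bar> * (2 * S)" using bd by (intro mult_left_mono) auto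
        finally show ?thesis by (simp add: B_def)
      qed
      ultimately have "if \<bar>u\<bar> \<le> \<bar>w\<bar> then (w, u, g, k) \<in> V else (u, w, g, k) \<in> V"
        using nz by (auto simp: V_def)
      moreover have "r = f1 (w, u, g, k)" "r = f2 (u, w, g, k)" by (auto simp: r f1_def f2_def)
      ultimately show "r \<in> U" unfolding U_def by (metis UnCI image_eqI)
    qed
    moreover have "finite U" using V by (simp add: U_def)
    ultimately have "card Z \<le> card U" by (rule card_inj_on_le)
    also have "\<dots> \<le> card (f1 ` V) + card (f2 ` V)" unfolding U_def by (rule card_Un_le)
    also have "\<dots> \<le> card V + card V" using V by (intro add_mono card_image_le)
    finally show ?thesis .
  qed
  ultimately have "real (card (equal_value_quadruples a S)) \<le> real (card ({1..S} \<times> {1..S})) + 2 * real (card V)"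
    by linarith
  also have "real (card ({1..S} \<times> {1..S})) = S\<^sup>2"
    using assms by (simp add: card_cartesian_product power2_eq_square)
  also have "2 * real (card V) \<le> 2 * (16 * B\<^sup>2 * (1 + ln B))" by (intro mult_left_mono V(2)) simp
  finally show ?thesis by (simp add: B_def power_mult_distrib)
qed

subsection \<open>A family of polynomials with many representations\<close>

lemma card_residue_class_le:
  fixes A :: "int set" and q :: int
  assumes "q > 0" "\<And>x y. x \<in> A \<Longrightarrow> y \<in> A \<Longrightarrow> real_of_int (x - y) \<le> L" "L \<ge> 0"
  shows "finite {x \<in> A. x mod q = r}" "real (card {x \<in> A. x mod q = r}) \<le> L / q + 1"
proof -
  have "q dvd x - y" if "x \<in> {x \<in> A. x mod q = r}" "y \<in> {x \<in> A. x mod q = r}" for x y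
    using that by (simp add: mod_eq_dvd_iff[symmetric])
  then show "finite {x \<in> A. x mod q = r}" "real (card {x \<in> A. x mod q = r}) \<le> L / q + 1"
    using assms card_congruent_le[of q "{x \<in> A. x mod q = r}" L] by auto
qed

text \<open>The variables are chosen in the order \<open>y\<^sub>1\<close>,
  \<open>x\<^sub>1\<close>, \<open>y\<^sub>2\<close>, \<open>x\<^sub>2\<close>, each from a range
  that depends only on earlier ones. Once its residue modulo \<open>q\<close> is prescribed, a
  variable in a range of length \<open>L\<close> has at most \<open>L / q + 1\<close> values;
  \<open>R\<close> holds the admissible residues.\<close>

lemma card_quadruples_by_residues_le:
  fixes Q :: "(int \<times> int \<times> int \<times> int) set" and q :: int
  assumes q: "q > 0" and R: "finite R"
    and A: "\<And>y y'. y \<in> A \<Longrightarrow> y' \<in> A \<Longrightarrow> real_of_int (y - y') \<le> \<alpha>" "\<alpha> \<ge> 0"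
    and B: "\<And>y x x'. x \<in> B y \<Longrightarrow> x' \<in> B y \<Longrightarrow> real_of_int (x - x') \<le> \<beta>" "\<beta> \<ge> 0"
    and D: "\<And>y x y' z z'. z \<in> D y x y' \<Longrightarrow> z' \<in> D y x y' \<Longrightarrow> real_of_int (z - z') \<le> \<delta>" "\<delta> \<ge> 0"
    and Q: "\<And>x\<^sub>1 y\<^sub>1 x\<^sub>2 y\<^sub>2. (x\<^sub>1, y\<^sub>1, x\<^sub>2, y\<^sub>2) \<in> Q \<Longrightarrow>
      y\<^sub>1 \<in> A \<and> x\<^sub>1 \<in> B y\<^sub>1 \<and> y\<^sub>2 \<in> A \<and> x\<^sub>2 \<in> D y\<^sub>1 x\<^sub>1 y\<^sub>2 \<and>
      (x\<^sub>1 mod q, y\<^sub>1 mod q, x\<^sub>2 mod q, y\<^sub>2 mod q) \<in> R"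
  shows "finite Q" "real (card Q) \<le> card R * ((\<alpha> / q + 1) * ((\<beta> / q + 1) * ((\<alpha> / q + 1) * (\<delta> / q + 1))))"
proof -
  define W where "W = (\<lambda>(r\<^sub>1, s\<^sub>1, r\<^sub>2, s\<^sub>2). SIGMA y\<^sub>1:{y \<in> A. y mod q = s\<^sub>1}. SIGMA x\<^sub>1:{x \<in> B y\<^sub>1. x mod q = r\<^sub>1}.
     SIGMA y\<^sub>2:{y \<in> A. y mod q = s\<^sub>2}. {x \<in> D y\<^sub>1 x\<^sub>1 y\<^sub>2. x mod q = r\<^sub>2})"
  define k where "k = (\<alpha> / q + 1) * ((\<beta> / q + 1) * ((\<alpha> / q + 1) * (\<delta> / q + 1)))"
  have cA: "finite {y \<in> A. y mod q = r}" "real (card {y \<in> A. y mod q = r}) \<le> \<alpha> / q + 1" for r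
    by (rule card_residue_class_le[OF q, of A \<alpha>]; use A in blast)+
  have cB: "finite {x \<in> B y. x mod q = r}" "real (card {x \<in> B y. x mod q = r}) \<le> \<beta> / q + 1" for y r
    by (rule card_residue_class_le[OF q, of "B y" \<beta>]; use B in blast)+
  have cD: "finite {z \<in> D y x y'. z mod q = r}" "real (card {z \<in> D y x y'. z mod q = r}) \<le> \<delta> / q + 1" for y x y' r
    by (rule card_residue_class_le[OF q, of "D y x y'" \<delta>]; use D in blast)+
  have nn: "\<alpha> / q + 1 \<ge> 0" "\<beta> / q + 1 \<ge> 0" "\<delta> / q + 1 \<ge> 0"
    using A(2) B(2) D(2) q by (auto intro!: add_nonneg_nonneg divide_nonneg_pos)
  have finW: "finite (W \<rho>)" for \<rho>
    unfolding W_def by (cases \<rho>) (simp only: prod.case, intro finite_SigmaI cA cB cD)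
  have cW: "real (card (W \<rho>)) \<le> k" for \<rho>
  proof -
    obtain r\<^sub>1 s\<^sub>1 r\<^sub>2 s\<^sub>2 where \<rho>: "\<rho> = (r\<^sub>1, s\<^sub>1, r\<^sub>2, s\<^sub>2)" by (cases \<rho>)
    \<comment> \<open>One level of the nested \<open>SIGMA\<close>: the bounds for base and fibres
      multiply.\<close>
    have step: "finite (SIGMA x:X. Y x) \<and> real (card (SIGMA x:X. Y x)) \<le> l * n"
      if "finite X" "real (card X) \<le> l" "\<And>x. finite (Y x) \<and> real (card (Y x)) \<le> n" "n \<ge> 0"
      for X :: "int set" and Y :: "int \<Rightarrow> 'b set" and l n
    proof -
      have "real (card (SIGMA x:X. Y x)) \<le> real (card X) * n" using that by (intro card_Sigma_le) auto
      also have "\<dots> \<le> l * n" using that by (intro mult_right_mono)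
      finally show ?thesis using that by auto
    qed
    have 3: "finite (SIGMA y\<^sub>2:{y \<in> A. y mod q = s\<^sub>2}. {x \<in> D y\<^sub>1 x\<^sub>1 y\<^sub>2. x mod q = r\<^sub>2}) \<and>
      real (card (SIGMA y\<^sub>2:{y \<in> A. y mod q = s\<^sub>2}. {x \<in> D y\<^sub>1 x\<^sub>1 y\<^sub>2. x mod q = r\<^sub>2}))
        \<le> (\<alpha> / q + 1) * (\<delta> / q + 1)" for y\<^sub>1 x\<^sub>1
      by (intro step conjI cA cD nn)
    have "real (card (W \<rho>)) \<le> (\<alpha> / q + 1) * ((\<beta> / q + 1) * ((\<alpha> / q + 1) * (\<delta> / q + 1)))"
      unfolding W_def \<rho> prod.case
      by (intro step[THEN conjunct2] step 3 cA cB mult_nonneg_nonneg nn)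
    then show ?thesis by (simp add: k_def)
  qed
  define f where "f = (\<lambda>(x\<^sub>1, y\<^sub>1, x\<^sub>2, y\<^sub>2). (y\<^sub>1, x\<^sub>1, y\<^sub>2, x\<^sub>2) :: int \<times> int \<times> int \<times> int)"
  have sub: "f ` Q \<subseteq> (\<Union>\<rho>\<in>R. W \<rho>)"
  proof
    fix p assume "p \<in> f ` Q"
    then obtain x\<^sub>1 y\<^sub>1 x\<^sub>2 y\<^sub>2 where p: "(x\<^sub>1, y\<^sub>1, x\<^sub>2, y\<^sub>2) \<in> Q" "p = (y\<^sub>1, x\<^sub>1, y\<^sub>2, x\<^sub>2)" by (auto simp: f_def)
    have "p \<in> W (x\<^sub>1 mod q, y\<^sub>1 mod q, x\<^sub>2 mod q, y\<^sub>2 mod q)" using Q[OF p(1)] p(2) by (simp add: W_def)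
    then show "p \<in> (\<Union>\<rho>\<in>R. W \<rho>)" using Q[OF p(1)] by blast
  qed
  have inj: "inj_on f Q" by (auto simp: inj_on_def f_def)
  have fin: "finite (\<Union>\<rho>\<in>R. W \<rho>)" using R finW by blast
  show "finite Q" using finite_subset[OF sub fin] inj by (simp add: finite_image_iff)
  have "card Q \<le> card (\<Union>\<rho>\<in>R. W \<rho>)" using inj sub fin by (rule card_inj_on_le)
  also have "\<dots> \<le> (\<Sum>\<rho>\<in>R. card (W \<rho>))" using R by (rule card_UN_le)
  also have "real \<dots> \<le> real (card R) * k"
    unfolding of_nat_sum using cW by (intro sum_bounded_above)
  finally show "real (card Q) \<le> card R * ((\<alpha> / q + 1) * ((\<beta> / q + 1) * ((\<alpha> / q + 1) * (\<delta> / q + 1))))"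
    by (simp add: k_def)
qed

text \<open>\<open>x^2 - y^2 = (x - y) * (x + y)\<close> with \<open>x + y \<ge> 2 * S\<close>; for
  \<open>x < y\<close> the claim is trivial.\<close>

lemma diff_le_of_squares_diff_le:
  fixes x y :: int and S E :: real
  assumes "S > 0" "S \<le> x" "S \<le> y" "real_of_int (x\<^sup>2 - y\<^sup>2) \<le> E" "E \<ge> 0"
  shows "real_of_int (x - y) \<le> E / (2 * S)"
proof (cases "x \<ge> y")
  case True
  then have "real_of_int (x - y) * (2 * S) \<le> real_of_int (x - y) * (x + y)"
    using assms by (intro mult_left_mono) auto
  also have "\<dots> = real_of_int (x\<^sup>2 - y\<^sup>2)" by (simp add: power2_eq_square algebra_simps)
  also have "\<dots> \<le> E" by fact
  finally show ?thesis using assms by (simp add: field_simps)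
next
  case False
  then have "real_of_int (x - y) \<le> 0" by simp
  also have "0 \<le> E / (2 * S)" using assms by simp
  finally show ?thesis .
qed

section \<open>Sizes of the values and of the variables\<close>

text \<open>A value of the polynomial has \<open>d + 1\<close> terms, each at most
  \<open>2 * h * (2 * T) ^ d\<close>; together they are at most \<open>(d + 1) * 2 ^ (d + 1)\<close>
  times \<open>h * T ^ d\<close>. The extra 1 leaves room for \<open>a * y^2\<close>.\<close>

definition value_const :: "nat \<Rightarrow> int" where
  "value_const d = (int d + 1) * 2 ^ (d + 1) + 1"

lemma value_const_ge: "value_const d \<ge> 1" by (simp add: value_const_def)

text \<open>Multiplied by \<open>h\<close>, \<open>big1\<close> and \<open>big2\<close> are the
  squares of \<open>4 * |a| * S\<^sub>1 \<le> h\<close> and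
  \<open>2 * T * S\<^sub>0 \<le> h\<close>. \<open>big3\<close> gives \<open>T ^ d \<le> h\<close>,
  and \<open>ln_le\<close> lets \<open>T\<close> absorb the logarithm in the diagonal count.\<close>

locale conic_family =
  fixes a h T :: int and d :: nat
  assumes a0: "a \<noteq> 0" and d0: "d > 0" and T1: "T \<ge> 1"
    and big1: "16 * a\<^sup>2 * value_const d * T ^ d \<le> h"
    and big2: "2 * T ^ (d + 2) \<le> h"
    and big3: "(2 * T) ^ d \<le> h"
    and ln_le: "ln h \<le> T"
begin

text \<open>\<open>M\<close> is the order of magnitude of the values. \<open>Y\<close> is chosen so
  that \<open>|a * y^2| \<le> M / 2\<close> whatever the sign of \<open>a\<close>; then
  \<open>x^2\<close> lies between \<open>S\<^sub>0^2 = M / 2\<close> and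
  \<open>S\<^sub>1^2 = value_const d * M\<close>.\<close>

definition M :: real where "M = real_of_int (h * T ^ d)"
definition Y :: int where "Y = \<lfloor>sqrt (M / (2 * \<bar>a\<bar>))\<rfloor>"
definition S\<^sub>0 :: real where "S\<^sub>0 = sqrt (M / 2)"
definition S\<^sub>1 :: real where "S\<^sub>1 = sqrt (value_const d * M)"
definition coeff_box :: "(nat \<Rightarrow> int) set" where "coeff_box = {..d} \<rightarrow>\<^sub>E {h..<2 * h}"
definition val :: "(nat \<Rightarrow> int) \<Rightarrow> int \<Rightarrow> int" where "val c t = (\<Sum>i\<le>d. c i * t ^ i)"
definition sols :: "(nat \<Rightarrow> int) \<Rightarrow> int \<Rightarrow> (int \<times> int) set" where
  "sols c t = {(x, y). x > 0 \<and> y \<in> {1..Y} \<and> x\<^sup>2 - a * y\<^sup>2 = val c t}"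

lemma h_pos: "h > 0"
  using big2 T1 by (smt (verit) zero_less_power)

lemma a_sq: "a\<^sup>2 \<ge> 1" "\<bar>a\<bar> \<ge> 1" "\<bar>a\<bar> \<le> a\<^sup>2"
proof -
  show "\<bar>a\<bar> \<ge> 1" using a0 by auto
  then have "\<bar>a\<bar> * 1 \<le> \<bar>a\<bar> * \<bar>a\<bar>" by (intro mult_left_mono) auto
  then show "\<bar>a\<bar> \<le> a\<^sup>2" by (simp add: power2_eq_square)
  then show "a\<^sup>2 \<ge> 1" using \<open>\<bar>a\<bar> \<ge> 1\<close> by linarith
qed

lemma Td: "T ^ d \<ge> 1" using T1 by simp

lemma M_ge_h: "M \<ge> h"
proof -
  have "h * 1 \<le> h * T ^ d" using Td h_pos by (intro mult_left_mono) auto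
  then show ?thesis unfolding M_def by (simp only: of_int_le_iff)
qed

lemma M_pos: "M > 0" using M_ge_h h_pos by linarith

lemma S0_pos: "S\<^sub>0 > 0" using M_pos by (simp add: S\<^sub>0_def)
lemma S1_pos: "S\<^sub>1 > 0" using M_pos value_const_ge[of d] by (simp add: S\<^sub>1_def)

lemma S0_sq: "S\<^sub>0\<^sup>2 = M / 2" using M_pos by (simp add: S\<^sub>0_def)
lemma S1_sq: "S\<^sub>1\<^sup>2 = value_const d * M" using M_pos value_const_ge[of d] by (simp add: S\<^sub>1_def)

lemma T_le_S0: "T \<le> S\<^sub>0"
proof -
  have "2 * T ^ 2 \<le> 2 * T ^ (d + 2)" using T1 by (intro mult_left_mono power_increasing) auto
  then have "real_of_int (2 * T ^ 2) \<le> h" using big2 by (simp only: of_int_le_iff)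
  then have "(real_of_int T)\<^sup>2 \<le> M / 2" using M_ge_h by simp
  then show ?thesis unfolding S\<^sub>0_def by (rule real_le_rsqrt)
qed

lemma T_S0_le: "2 * T * S\<^sub>0 \<le> h"
proof (rule power2_le_imp_le)
  have "h * (2 * T ^ (d + 2)) \<le> h * h" using big2 h_pos by (intro mult_left_mono) auto
  then have "real_of_int (h * (2 * T ^ (d + 2))) \<le> real_of_int (h * h)" by (simp only: of_int_le_iff)
  then show "(2 * T * S\<^sub>0)\<^sup>2 \<le> (real_of_int h)\<^sup>2"
    unfolding power_mult_distrib S0_sq M_def by (simp add: power_add power2_eq_square mult_ac)
qed (use h_pos in auto)

lemma S1_a_le: "4 * \<bar>a\<bar> * S\<^sub>1 \<le> h"
proof (rule power2_le_imp_le)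
  have "h * (16 * a\<^sup>2 * value_const d * T ^ d) \<le> h * h" using big1 h_pos by (intro mult_left_mono) auto
  then have "real_of_int (h * (16 * a\<^sup>2 * value_const d * T ^ d)) \<le> real_of_int (h * h)" by (simp only: of_int_le_iff)
  then show "(4 * \<bar>a\<bar> * S\<^sub>1)\<^sup>2 \<le> (real_of_int h)\<^sup>2"
    unfolding power_mult_distrib S1_sq M_def by (simp add: mult_ac)
      (simp add: power2_eq_square mult_ac)
qed (use h_pos in auto)

lemma S1_le: "4 * S\<^sub>1 \<le> h"
proof -
  have "4 * S\<^sub>1 * 1 \<le> 4 * S\<^sub>1 * \<bar>a\<bar>" using a_sq S1_pos by (intro mult_left_mono) auto
  then show ?thesis using S1_a_le by (simp add: mult_ac)
qed

lemma Y_le_S0: "Y \<le> S\<^sub>0"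
proof -
  have "Y \<le> sqrt (M / (2 * \<bar>a\<bar>))" by (simp add: Y_def)
  also have "M / (2 * \<bar>a\<bar>) \<le> M / 2" using M_pos a_sq
    by (intro divide_left_mono) auto
  then have "sqrt (M / (2 * \<bar>a\<bar>)) \<le> S\<^sub>0" by (simp add: S\<^sub>0_def)
  finally show ?thesis .
qed

lemma S0_le_S1: "S\<^sub>0 \<le> S\<^sub>1"
proof -
  have "1 * M \<le> value_const d * M" using M_pos value_const_ge[of d] by (intro mult_right_mono) auto
  then show ?thesis using M_pos unfolding S\<^sub>0_def S\<^sub>1_def by (intro real_sqrt_le_mono) linarith
qed

text \<open>Without the floor, \<open>Y\<close> would be exactly
  \<open>S\<^sub>1 / sqrt (2 * |a| * value_const d)\<close>; as this number is at least 1, the floor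
  costs at most a factor 2.\<close>

lemma Y_ge: "S\<^sub>1 / (2 * sqrt (2 * \<bar>a\<bar> * value_const d)) \<le> Y"
proof -
  define s where "s = sqrt (M / (2 * \<bar>a\<bar>))"
  have "16 * a\<^sup>2 * 1 * 1 \<le> 16 * a\<^sup>2 * value_const d * T ^ d"
    using Td value_const_ge[of d] by (intro mult_mono) auto
  then have "2 * \<bar>a\<bar> \<le> h" using big1 a_sq by linarith
  then have "2 * real_of_int \<bar>a\<bar> \<le> M" using M_ge_h by linarith
  then have "M / (2 * \<bar>a\<bar>) \<ge> 1" using a_sq by (simp add: field_simps)
  then have "s \<ge> 1" by (simp add: s_def)
  then have "\<lfloor>s\<rfloor> \<ge> 1" by simp
  then have "Y \<ge> s / 2" unfolding Y_def s_def[symmetric] by linarith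
  moreover have "s = S\<^sub>1 / sqrt (2 * \<bar>a\<bar> * value_const d)"
    using a_sq value_const_ge[of d]
    by (simp add: s_def S\<^sub>1_def real_sqrt_divide[symmetric] real_sqrt_mult[symmetric] del: real_sqrt_mult)
  ultimately show ?thesis by simp
qed

lemma a_y_sq_le:
  assumes "y \<in> {1..Y}"
  shows "\<bar>real_of_int (a * y\<^sup>2)\<bar> \<le> M / 2"
proof -
  have "real_of_int y \<le> sqrt (M / (2 * \<bar>a\<bar>))" using assms by (auto simp: Y_def le_floor_iff)
  then have "(real_of_int y)\<^sup>2 \<le> (sqrt (M / (2 * \<bar>a\<bar>)))\<^sup>2"
    using assms by (intro power_mono) auto
  also have "\<dots> = M / (2 * \<bar>a\<bar>)" using M_pos a_sq by simp
  finally show ?thesis using a_sq by (simp add: abs_mult field_simps)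
qed

lemma val_ge:
  assumes "\<And>i. i \<le> d \<Longrightarrow> 0 \<le> c i" "h \<le> c d" "t \<ge> T"
  shows "h * T ^ d \<le> val c t"
proof -
  have "h * T ^ d \<le> c d * t ^ d" using assms T1 h_pos by (intro mult_mono power_mono) auto
  also have "\<dots> = (\<Sum>i\<in>{d}. c i * t ^ i)" by simp
  also have "\<dots> \<le> val c t"
    unfolding val_def using assms T1 by (intro sum_mono2) auto
  finally show ?thesis .
qed

text \<open>The bound \<open>c i \<le> 2 * h\<close> is not strict, so that it also covers the
  endpoint \<open>2 * h\<close> of the constant coefficient in \<open>first_moment\<close>, which
  lies outside the box.\<close>

lemma val_le:
  assumes "\<And>i. i \<le> d \<Longrightarrow> 0 \<le> c i" "\<And>i. i \<le> d \<Longrightarrow> c i \<le> 2 * h" "t \<in> {T..<2 * T}"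
  shows "val c t \<le> (value_const d - 1) * (h * T ^ d)"
proof -
  have "val c t \<le> (\<Sum>i\<le>d. 2 * h * (2 * T) ^ d)"
    unfolding val_def
  proof (intro sum_mono mult_mono)
    fix i assume i: "i \<in> {..d}"
    have "t ^ i \<le> (2 * T) ^ i" using assms T1 by (intro power_mono) auto
    also have "\<dots> \<le> (2 * T) ^ d" using T1 i by (intro power_increasing) auto
    finally show "t ^ i \<le> (2 * T) ^ d" .
  qed (use assms T1 h_pos in auto)
  also have "\<dots> = (value_const d - 1) * (h * T ^ d)"
    by (simp add: value_const_def power_mult_distrib algebra_simps)
  finally show ?thesis .
qed

text \<open>The value lies between \<open>M\<close> and \<open>(value_const d - 1) * M\<close>, and
  \<open>a * y^2\<close> shifts it by at most \<open>M / 2\<close>.\<close>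

lemma sols_bounds:
  assumes "c \<in> coeff_box" "t \<in> {T..<2 * T}" "(x, y) \<in> sols c t"
  shows "S\<^sub>0 \<le> x" "x \<le> S\<^sub>1" "x > 0" "y \<in> {1..Y}" "x\<^sup>2 - a * y\<^sup>2 = val c t"
proof -
  show xy: "x > 0" "y \<in> {1..Y}" "x\<^sup>2 - a * y\<^sup>2 = val c t" using assms by (auto simp: sols_def)
  have c: "h \<le> c i \<and> c i < 2 * h" if "i \<le> d" for i using assms that by (auto simp: coeff_box_def PiE_def Pi_def)
  have "real_of_int (h * T ^ d) \<le> real_of_int (val c t)"
    unfolding of_int_le_iff using c h_pos assms by (intro val_ge) force+
  then have v1: "M \<le> val c t" by (simp add: M_def)
  have "real_of_int (val c t) \<le> real_of_int ((value_const d - 1) * (h * T ^ d))"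
    unfolding of_int_le_iff using c h_pos assms by (intro val_le) force+
  then have v2: "val c t \<le> (value_const d - 1) * M" by (simp add: M_def)
  have e: "(real_of_int x)\<^sup>2 = val c t + real_of_int (a * y\<^sup>2)" using xy(3)
    by (metis add_diff_cancel_right' diff_add_cancel of_int_add of_int_power)
  note ay = a_y_sq_le[OF xy(2)]
  have "M / 2 \<le> (real_of_int x)\<^sup>2" using e v1 ay by linarith
  then show "S\<^sub>0 \<le> x" unfolding S\<^sub>0_def using xy by (intro real_le_lsqrt) auto
  have "(real_of_int x)\<^sup>2 \<le> value_const d * M" using e v2 ay M_pos by (simp add: algebra_simps)
  then show "x \<le> S\<^sub>1" unfolding S\<^sub>1_def by (rule real_le_rsqrt)
qed

lemma finite_coeff_box: "finite coeff_box" by (auto simp: coeff_box_def intro!: finite_PiE)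

lemma finite_sols:
  assumes "c \<in> coeff_box" "t \<in> {T..<2 * T}"
  shows "finite (sols c t)"
proof (rule finite_subset)
  show "sols c t \<subseteq> {1..\<lfloor>S\<^sub>1\<rfloor>} \<times> {1..Y}"
    using sols_bounds[OF assms] by (fastforce simp: le_floor_iff)
qed simp

lemma card_box: "finite I \<Longrightarrow> real (card (I \<rightarrow>\<^sub>E {h..<2 * h})) = real_of_int h ^ card I"
  using h_pos by (simp add: card_funcsetE)

lemma coeff_box_bounds: "c \<in> coeff_box \<Longrightarrow> i \<le> d \<Longrightarrow> h \<le> c i \<and> c i < 2 * h"
  by (auto simp: coeff_box_def PiE_def Pi_def)

lemma coeff_box_eqI:
  assumes "c \<in> coeff_box" "c' \<in> coeff_box" "\<And>i. i \<le> d \<Longrightarrow> c i = c' i"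
  shows "c = c'"
proof
  fix i show "c i = c' i"
    using assms by (cases "i \<le> d") (auto simp: coeff_box_def PiE_def extensional_def)
qed

section \<open>First moment\<close>

text \<open>With \<open>y\<close> and the coefficients of positive degree fixed, the constant
  coefficient sweeps the value through an interval of length \<open>h\<close>, and every
  \<open>x\<close> with \<open>x^2 - a * y^2\<close> in it determines that coefficient. There are
  \<open>h ^ d * Y\<close> choices, each with at least \<open>h / (4 * S\<^sub>1)\<close> such
  \<open>x\<close>.\<close>

lemma first_moment:
  assumes t: "t \<in> {T..<2 * T}"
  shows "h ^ (d + 1) / (8 * sqrt (2 * \<bar>a\<bar> * value_const d)) \<le> (\<Sum>c\<in>coeff_box. real (card (sols c t)))"
proof -
  define G where "G = {1..d} \<rightarrow>\<^sub>E {h..<2 * h}"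
  define w where "w = (\<lambda>g. \<Sum>i\<in>{1..d}. g i * t ^ i :: int)"
  define X where "X = (\<lambda>g y. {x :: int. x > 0 \<and> h + w g + a * y\<^sup>2 \<le> x\<^sup>2 \<and> x\<^sup>2 < h + w g + a * y\<^sup>2 + h})"
  define f where "f = (\<lambda>(g, y, x). (g(0 := x\<^sup>2 - a * y\<^sup>2 - w g), (x, y)))"
  have atMost: "{..d} = insert 0 {1..d}" by auto
  have valu: "val (g(0 := v)) t = v + w g" for g v
    unfolding val_def atMost w_def by (subst sum.insert) auto
  have Gb: "h \<le> g i \<and> g i < 2 * h" if "g \<in> G" "i \<in> {1..d}" for g i
    using that by (auto simp: G_def PiE_def Pi_def)
  have X: "h / (4 * S\<^sub>1) \<le> real (card (X g y))" if g: "g \<in> G" and y: "y \<in> {1..Y}" for g y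
  proof -
    \<comment> \<open>This is applied with \<open>v = h\<close> and \<open>v = 2 * h\<close>, the
      two ends of the sweep.\<close>
    have bd: "0 \<le> (g(0 := v)) i \<and> (g(0 := v)) i \<le> 2 * h" if "0 \<le> v" "v \<le> 2 * h" "i \<le> d" for i v
      using Gb[OF g, of i] that h_pos by (cases "i = 0") auto
    have "h * T ^ d \<le> val (g(0 := h)) t"
      using bd[of h] h_pos t Gb[OF g, of d] d0 by (intro val_ge) auto
    then have "real_of_int (h * T ^ d) \<le> real_of_int (h + w g)" unfolding valu of_int_le_iff .
    then have 1: "M \<le> h + w g" by (simp add: M_def)
    have "val (g(0 := 2 * h)) t \<le> (value_const d - 1) * (h * T ^ d)"
      using bd[of "2 * h"] h_pos t by (intro val_le) auto
    then have "real_of_int (2 * h + w g) \<le> real_of_int ((value_const d - 1) * (h * T ^ d))"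
      unfolding valu of_int_le_iff .
    then have 2: "real_of_int (2 * h + w g) \<le> (value_const d - 1) * M" by (simp add: M_def)
    note ay = a_y_sq_le[OF y]
    have "real_of_int (h + w g + a * y\<^sup>2) > 0" using 1 ay M_pos by simp
    then have pos: "h + w g + a * y\<^sup>2 > 0" by (simp only: of_int_0_less_iff)
    have "real_of_int (h + w g + a * y\<^sup>2 + h) \<le> S\<^sub>1\<^sup>2"
      using 2 ay M_pos unfolding S1_sq by (simp add: algebra_simps)
    then have "h / (2 * S\<^sub>1) - 1 \<le> real (card (X g y))"
      unfolding X_def using pos h_pos S1_pos by (intro card_squares_in_interval_ge) auto
    \<comment> \<open>Since \<open>h / (2 * S\<^sub>1) \<ge> 2\<close>, subtracting 1 at most halves
      it.\<close>
    moreover have "1 \<le> h / (4 * S\<^sub>1)" using S1_le S1_pos by (simp add: field_simps)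
    ultimately show ?thesis by (simp add: field_simps)
  qed
  have finX: "finite (X g y)" for g y
  proof (rule finite_subset)
    show "X g y \<subseteq> {0..h + w g + a * y\<^sup>2 + h}"
    proof
      fix x assume x: "x \<in> X g y"
      then have "x * 1 \<le> x * x" by (intro mult_left_mono) (auto simp: X_def)
      then have "x \<le> x\<^sup>2" by (simp only: power2_eq_square mult_1_right)
      then show "x \<in> {0..h + w g + a * y\<^sup>2 + h}" using x unfolding X_def mem_Collect_eq atLeastAtMost_iff
        by linarith
    qed
  qed simp
  have "card (SIGMA g:G. SIGMA y:{1..Y}. X g y) \<le> card (SIGMA c:coeff_box. sols c t)"
  proof (rule card_inj_on_le)
    show "inj_on f (SIGMA g:G. SIGMA y:{1..Y}. X g y)"
    proof (rule inj_onI)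
      fix p p' assume pp: "p \<in> (SIGMA g:G. SIGMA y:{1..Y}. X g y)"
        "p' \<in> (SIGMA g:G. SIGMA y:{1..Y}. X g y)" "f p = f p'"
      obtain g y x where p: "p = (g, y, x)" by (cases p)
      obtain g' y' x' where p': "p' = (g', y', x')" by (cases p')
      have "g \<in> G" "g' \<in> G" using pp p p' by auto
      \<comment> \<open>Functions in \<open>G\<close> are \<open>undefined\<close> at 0, so an
        update at 0 loses no information and can be reverted.\<close>
      then have "g 0 = undefined" "g' 0 = undefined" by (auto simp: G_def PiE_def extensional_def)
      moreover have "g(0 := v) = g'(0 := v')" "x = x'" "y = y'"
        if "v = x\<^sup>2 - a * y\<^sup>2 - w g" "v' = x'\<^sup>2 - a * y'\<^sup>2 - w g'" for v v'
        using pp(3) that by (auto simp: p p' f_def)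
      ultimately show "p = p'" unfolding p p' by (metis fun_upd_triv fun_upd_upd)
    qed
    show "f ` (SIGMA g:G. SIGMA y:{1..Y}. X g y) \<subseteq> (SIGMA c:coeff_box. sols c t)"
    proof
      fix r assume "r \<in> f ` (SIGMA g:G. SIGMA y:{1..Y}. X g y)"
      then obtain g y x where p: "g \<in> G" "y \<in> {1..Y}" "x \<in> X g y" "r = f (g, y, x)" by auto
      define v where "v = x\<^sup>2 - a * y\<^sup>2 - w g"
      have "v \<in> {h..<2 * h}" using p by (auto simp: X_def v_def)
      then have "g(0 := v) \<in> coeff_box"
        unfolding coeff_box_def atMost PiE_insert_eq using p(1) unfolding G_def by (intro image_eqI[of _ _ "(v, g)"]) auto
      moreover have "(x, y) \<in> sols (g(0 := v)) t"
        using p unfolding sols_def valu by (auto simp: X_def v_def)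
      ultimately show "r \<in> (SIGMA c:coeff_box. sols c t)" by (simp add: p f_def v_def)
    qed
    show "finite (SIGMA c:coeff_box. sols c t)" using finite_coeff_box finite_sols[OF _ t] by auto
  qed
  also have "\<dots> = (\<Sum>c\<in>coeff_box. card (sols c t))"
    using finite_coeff_box finite_sols[OF _ t] by (subst card_SigmaI) auto
  finally have le: "real (card (SIGMA g:G. SIGMA y:{1..Y}. X g y)) \<le> (\<Sum>c\<in>coeff_box. real (card (sols c t)))"
    by (simp only: of_nat_le_iff flip: of_nat_sum)
  have "Y \<ge> 0" using Y_ge S1_pos value_const_ge[of d]
    by (smt (verit) divide_nonneg_nonneg of_int_0_le_iff real_sqrt_ge_zero mult_nonneg_nonneg of_int_nonneg)
  have finG: "finite G" by (auto simp: G_def intro!: finite_PiE)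
  have "h ^ (d + 1) / (8 * sqrt (2 * \<bar>a\<bar> * value_const d)) =
      h ^ d * (S\<^sub>1 / (2 * sqrt (2 * \<bar>a\<bar> * value_const d)) * (h / (4 * S\<^sub>1)))"
    using S1_pos by simp
  also have "\<dots> \<le> h ^ d * (Y * (h / (4 * S\<^sub>1)))"
    using Y_ge h_pos S1_pos by (intro mult_left_mono mult_right_mono) auto
  also have "\<dots> = (\<Sum>g\<in>G. \<Sum>y\<in>{1..Y}. h / (4 * S\<^sub>1))"
    using card_box[of "{1..d}"] \<open>Y \<ge> 0\<close> by (simp add: G_def)
  also have "\<dots> \<le> (\<Sum>g\<in>G. \<Sum>y\<in>{1..Y}. real (card (X g y)))"
    using X by (intro sum_mono) auto
  also have "\<dots> = real (card (SIGMA g:G. SIGMA y:{1..Y}. X g y))"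
    using finG finX by (subst card_SigmaI) (auto simp: card_SigmaI)
  finally show ?thesis using le by linarith
qed

section \<open>Second moment: equal arguments\<close>

text \<open>With \<open>c i\<close> fixed for \<open>0 < i < d\<close>, the equation prescribes
  \<open>c 0 + c d * t ^ d\<close>: this fixes \<open>c 0\<close> modulo \<open>t ^ d\<close>, and
  \<open>c 0\<close> determines \<open>c d\<close>. The \<open>+ 1\<close> in the count of the
  residue class is absorbed by \<open>T ^ d \<le> h\<close>.\<close>

lemma card_fiber_le:
  assumes t: "t \<in> {T..<2 * T}"
  shows "real (card {c \<in> coeff_box. val c t = n}) \<le> 2 * h ^ d / T ^ d"
proof -
  define G where "G = {1..<d} \<rightarrow>\<^sub>E {h..<2 * h}"
  define w where "w = (\<lambda>g. \<Sum>i\<in>{1..<d}. g i * t ^ i :: int)"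
  define X where "X = (\<lambda>g. {z \<in> {h..<2 * h}. z mod t ^ d = (n - w g) mod t ^ d})"
  define f where "f = (\<lambda>c :: nat \<Rightarrow> int. (restrict c {1..<d}, c 0))"
  have atMost: "{..d} = insert 0 (insert d {1..<d})" using d0 by auto
  have valu: "val c t = c 0 + c d * t ^ d + w (restrict c {1..<d})" for c
    unfolding val_def atMost w_def using d0 by (subst sum.insert) auto
  have tpos: "t > 0" "t \<ge> T" using t T1 by auto
  then have td: "t ^ d > 0" by simp
  have X: "finite (X g)" "real (card (X g)) \<le> h / (t ^ d) + 1" for g
    unfolding X_def using card_residue_class_le[OF td, of "{h..<2 * h}" "h"] h_pos by auto
  have finG: "finite G" by (auto simp: G_def intro!: finite_PiE)
  have "card {c \<in> coeff_box. val c t = n} \<le> card (SIGMA g:G. X g)"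
  proof (rule card_inj_on_le)
    show "inj_on f {c \<in> coeff_box. val c t = n}"
    proof (rule inj_onI)
      fix c c' assume cc: "c \<in> {c \<in> coeff_box. val c t = n}" "c' \<in> {c \<in> coeff_box. val c t = n}" "f c = f c'"
      have r: "restrict c {1..<d} = restrict c' {1..<d}" "c 0 = c' 0" using cc by (auto simp: f_def)
      moreover have "val c t = val c' t" using cc by simp
      ultimately have "c d * t ^ d = c' d * t ^ d" unfolding valu by simp
      then have cd: "c d = c' d" using tpos by simp
      show "c = c'"
      proof (rule coeff_box_eqI)
        fix i assume "i \<le> d"
        then have "i \<in> insert 0 (insert d {1..<d})" using atMost by blast
        then show "c i = c' i" using r cd by (metis insertE restrict_apply')
      qed (use cc in auto)
    qed
    show "f ` {c \<in> coeff_box. val c t = n} \<subseteq> (SIGMA g:G. X g)"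
    proof
      fix r assume "r \<in> f ` {c \<in> coeff_box. val c t = n}"
      then obtain c where c: "c \<in> coeff_box" "val c t = n" "r = f c" by auto
      have "restrict c {1..<d} \<in> G"
        using coeff_box_bounds[OF c(1)] by (auto simp: G_def)
      moreover have "c 0 mod t ^ d = (n - w (restrict c {1..<d})) mod t ^ d"
        using c(2) unfolding valu by auto
      ultimately show "r \<in> (SIGMA g:G. X g)"
        using coeff_box_bounds[OF c(1), of 0] c(3) by (auto simp: f_def X_def)
    qed
    show "finite (SIGMA g:G. X g)" using finG X by auto
  qed
  also have "real \<dots> \<le> real (card G) * (h / (t ^ d) + 1)"
    using finG X h_pos tpos by (intro card_Sigma_le) (auto intro!: add_nonneg_nonneg divide_nonneg_nonneg)
  also have "real (card G) = h ^ (d - 1)" unfolding G_def using card_box[of "{1..<d}"] by simp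
  also have "h ^ (d - 1) * (h / (t ^ d) + 1) \<le> h ^ (d - 1) * (2 * h / T ^ d)"
  proof (intro mult_left_mono)
    have "T ^ d \<le> t ^ d" using tpos T1 by (intro power_mono) auto
    then have Tt: "real_of_int (T ^ d) \<le> real_of_int (t ^ d)" by (simp only: of_int_le_iff)
    have "T ^ d \<le> (2 * T) ^ d" using T1 by (intro power_mono) auto
    then have "T ^ d \<le> h" using big3 by linarith
    then have Th: "real_of_int (T ^ d) \<le> h" by (simp only: of_int_le_iff)
    have Tp: "real_of_int (T ^ d) > 0" using T1 by simp
    have "h / (t ^ d) \<le> h / real_of_int (T ^ d)" using Tt Tp h_pos
      by (intro divide_left_mono) auto
    moreover have "1 \<le> h / real_of_int (T ^ d)" using Th Tp by (simp add: field_simps)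
    ultimately show "h / (t ^ d) + 1 \<le> 2 * h / T ^ d" by simp
  qed (use h_pos in auto)
  also have "\<dots> = 2 * h ^ d / T ^ d"
    using d0 by (cases d) auto
  finally show ?thesis by simp
qed

text \<open>Two solutions for the same \<open>c\<close> and \<open>t\<close> form a member of
  \<open>equal_value_quadruples\<close>, and \<open>card_fiber_le\<close> bounds the number of
  \<open>c\<close> attaining its common value.\<close>

lemma diagonal_second_moment:
  assumes t: "t \<in> {T..<2 * T}"
  shows "(\<Sum>c\<in>coeff_box. real (card (sols c t \<times> sols c t))) \<le> 514 * a\<^sup>2 * value_const d * h ^ (d + 1) * T"
proof -
  define S where "S = \<lfloor>S\<^sub>1\<rfloor>"
  define E where "E = equal_value_quadruples a S"
  define X where "X = (\<lambda>(x\<^sub>1, y\<^sub>1, x\<^sub>2 :: int, y\<^sub>2 :: int). {c \<in> coeff_box. val c t = x\<^sub>1\<^sup>2 - a * y\<^sub>1\<^sup>2})"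
  define f where "f = (\<lambda>(c :: nat \<Rightarrow> int, (x\<^sub>1 :: int, y\<^sub>1 :: int), (x\<^sub>2 :: int, y\<^sub>2 :: int)). ((x\<^sub>1, y\<^sub>1, x\<^sub>2, y\<^sub>2), c))"
  have finE: "finite E" by (simp add: E_def finite_equal_value_quadruples)
  have X: "finite (X p)" "real (card (X p)) \<le> 2 * h ^ d / T ^ d" for p
    using finite_coeff_box card_fiber_le[OF t] unfolding X_def by (cases p; simp)+
  have "S\<^sub>0 \<ge> 1" using T_le_S0 T1 by linarith
  then have "S\<^sub>1 \<ge> 1" using S0_le_S1 by linarith
  then have S1: "S \<ge> 1" "S \<le> S\<^sub>1" by (auto simp: S_def)
  have "(\<Sum>c\<in>coeff_box. card (sols c t \<times> sols c t)) = card (SIGMA c:coeff_box. sols c t \<times> sols c t)"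
    using finite_coeff_box finite_sols[OF _ t] by (subst card_SigmaI) auto
  also have "\<dots> \<le> card (SIGMA p:E. X p)"
  proof (rule card_inj_on_le)
    show "inj_on f (SIGMA c:coeff_box. sols c t \<times> sols c t)" by (auto simp: inj_on_def f_def)
    show "f ` (SIGMA c:coeff_box. sols c t \<times> sols c t) \<subseteq> (SIGMA p:E. X p)"
    proof
      fix r assume "r \<in> f ` (SIGMA c:coeff_box. sols c t \<times> sols c t)"
      then obtain c x\<^sub>1 y\<^sub>1 x\<^sub>2 y\<^sub>2 where c: "c \<in> coeff_box" "(x\<^sub>1, y\<^sub>1) \<in> sols c t" "(x\<^sub>2, y\<^sub>2) \<in> sols c t"
        "r = f (c, (x\<^sub>1, y\<^sub>1), (x\<^sub>2, y\<^sub>2))" by auto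
      note b1 = sols_bounds[OF c(1) t c(2)] and b2 = sols_bounds[OF c(1) t c(3)]
      have YS: "Y \<le> S" using Y_le_S0 S0_le_S1 unfolding S_def le_floor_iff by linarith
      have "x\<^sub>1 \<in> {1..S}" "x\<^sub>2 \<in> {1..S}" using b1 b2 by (auto simp: S_def le_floor_iff)
      moreover have "y\<^sub>1 \<in> {1..S}" "y\<^sub>2 \<in> {1..S}" using b1(4) b2(4) YS by auto
      ultimately have "(x\<^sub>1, y\<^sub>1, x\<^sub>2, y\<^sub>2) \<in> E"
        using b1(5) b2(5) by (simp add: E_def equal_value_quadruples_def)
      moreover have "c \<in> X (x\<^sub>1, y\<^sub>1, x\<^sub>2, y\<^sub>2)" using c(1) b1(5) by (simp add: X_def)
      ultimately show "r \<in> (SIGMA p:E. X p)" by (simp add: c(4) f_def)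
    qed
    show "finite (SIGMA p:E. X p)" using finE X by auto
  qed
  finally have "(\<Sum>c\<in>coeff_box. real (card (sols c t \<times> sols c t))) \<le> real (card (SIGMA p:E. X p))"
    by (simp only: of_nat_le_iff flip: of_nat_sum)
  also have "\<dots> \<le> real (card E) * (2 * h ^ d / T ^ d)"
    using finE X h_pos T1 by (intro card_Sigma_le) auto
  also have "\<dots> \<le> (257 * a\<^sup>2 * value_const d * M * T) * (2 * h ^ d / T ^ d)"
  proof (intro mult_right_mono)
    have "real (card E) \<le> S\<^sup>2 + 128 * a\<^sup>2 * S\<^sup>2 * (1 + ln (2 * \<bar>a\<bar> * S))"
      unfolding E_def using card_equal_value_quadruples_le[OF a0 S1(1)] by simp
    also have "\<dots> \<le> S\<^sup>2 * (257 * a\<^sup>2 * T)"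
    proof -
      \<comment> \<open>The argument of the logarithm is at most \<open>h\<close>, so the logarithm
        is at most \<open>T\<close>; this is why \<open>T\<close> has to be as large as
        \<open>ln h\<close>.\<close>
      have "2 * \<bar>a\<bar> * S \<le> 2 * \<bar>a\<bar> * S\<^sub>1"
        using mult_left_mono[OF S1(2), of "2 * \<bar>a\<bar>"] by simp
      also have "\<dots> \<le> 4 * \<bar>a\<bar> * S\<^sub>1" using S1_pos by (intro mult_right_mono) auto
      also have "\<dots> \<le> h" by (rule S1_a_le)
      finally have "ln (2 * \<bar>a\<bar> * S) \<le> ln h" using S1 a_sq a0 by (intro ln_mono) auto
      then have "1 + ln (2 * \<bar>a\<bar> * S) \<le> 2 * T" using ln_le T1 by linarith
      then have "real_of_int (128 * a\<^sup>2) * (1 + ln (2 * \<bar>a\<bar> * S)) \<le> real_of_int (128 * a\<^sup>2) * (2 * T)"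
        by (intro mult_left_mono) auto
      moreover have "1 * 1 \<le> real_of_int (a\<^sup>2) * real_of_int T"
      proof (rule mult_mono)
        show "1 \<le> real_of_int (a\<^sup>2)" using a_sq(1) by (simp only: of_int_1_le_iff)
      qed (use T1 in auto)
      \<comment> \<open>\<open>257 = 1 + 128 * 2\<close>; the factor 2 of the fibre bound later
        doubles it to 514.\<close>
      ultimately have "1 + 128 * real_of_int (a\<^sup>2) * (1 + ln (2 * \<bar>a\<bar> * S)) \<le> 257 * real_of_int (a\<^sup>2) * T"
        by (simp add: algebra_simps)
      then have "(real_of_int S)\<^sup>2 * (1 + 128 * real_of_int (a\<^sup>2) * (1 + ln (2 * \<bar>a\<bar> * S)))
          \<le> (real_of_int S)\<^sup>2 * (257 * real_of_int (a\<^sup>2) * T)"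
        by (intro mult_left_mono) auto
      then show ?thesis by (simp add: algebra_simps)
    qed
    also have "\<dots> = (real_of_int S)\<^sup>2 * real_of_int (257 * a\<^sup>2 * T)" by simp
    also have "\<dots> \<le> S\<^sub>1\<^sup>2 * real_of_int (257 * a\<^sup>2 * T)"
      using S1 T1 by (intro mult_right_mono power_mono) auto
    finally show "real (card E) \<le> 257 * a\<^sup>2 * value_const d * M * T"
      unfolding S1_sq by (simp add: mult_ac)
  qed (use h_pos T1 in auto)
  also have "\<dots> = 514 * a\<^sup>2 * value_const d * h ^ (d + 1) * T"
    using T1 by (simp add: M_def)
  finally show ?thesis .
qed

section \<open>Second moment: distinct arguments\<close>

lemma diff_dvd_val_diff: "t\<^sub>1 - t\<^sub>2 dvd val c t\<^sub>1 - val c t\<^sub>2"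
proof -
  have "val c t\<^sub>1 - val c t\<^sub>2 = (\<Sum>i\<le>d. c i * (t\<^sub>1 ^ i - t\<^sub>2 ^ i))"
    by (simp add: val_def sum_subtractf right_diff_distrib)
  moreover have "t\<^sub>1 - t\<^sub>2 dvd t\<^sub>1 ^ i - t\<^sub>2 ^ i" for i
    by (metis dvd_triv_left power_diff_sumr2)
  ultimately show ?thesis by (auto intro!: dvd_sum)
qed

text \<open>\<open>g\<close> holds the coefficients of degree at least 2. The two lowest ones can
  stay under the quantifier, because the values at two distinct arguments determine them.\<close>

definition tail_sols :: "int \<Rightarrow> int \<Rightarrow> (nat \<Rightarrow> int) \<Rightarrow> (int \<times> int \<times> int \<times> int) set" where
  "tail_sols t\<^sub>1 t\<^sub>2 g = {(x\<^sub>1, y\<^sub>1, x\<^sub>2, y\<^sub>2). \<exists>c\<in>coeff_box. restrict c {2..d} = g \<and>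
     (x\<^sub>1, y\<^sub>1) \<in> sols c t\<^sub>1 \<and> (x\<^sub>2, y\<^sub>2) \<in> sols c t\<^sub>2}"

lemma val_split:
  "val c t = c 0 + c 1 * t + (\<Sum>i\<in>{2..d}. restrict c {2..d} i * t ^ i)"
proof -
  have "{..d} = insert 0 (insert 1 {2..d})" using d0 by auto
  then show ?thesis unfolding val_def by simp
qed

text \<open>With the coefficients of degree at least \<open>2\<close> fixed, \<open>x\<^sub>1\<close> is confined to an interval of length
  \<open>h T / S\<^sub>0\<close> by the range of \<open>c\<^sub>0 + c\<^sub>1 t\<^sub>1\<close>; then \<open>c\<^sub>1\<close> is known up to \<open>h / t\<^sub>1\<close>, which confines
  \<open>x\<^sub>2\<close> to an interval of length \<open>q h / (2 T S\<^sub>0)\<close>.\<close>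

lemma card_tail_sols_le:
  assumes t: "t\<^sub>1 \<in> {T..<2 * T}" "t\<^sub>2 \<in> {T..<2 * T}" "t\<^sub>1 \<noteq> t\<^sub>2"
  shows "finite (tail_sols t\<^sub>1 t\<^sub>2 g)"
    "real (card (tail_sols t\<^sub>1 t\<^sub>2 g)) \<le> 16 * \<bar>a\<bar> * h\<^sup>2 * inverse_divisor_sum \<bar>t\<^sub>1 - t\<^sub>2\<bar>"
proof -
  define q where "q = \<bar>t\<^sub>1 - t\<^sub>2\<bar>"
  have q: "q > 0" "q \<le> T" using t by (auto simp: q_def)
  define w where "w = (\<lambda>t. \<Sum>i\<in>{2..d}. g i * t ^ i :: int)"
  define B where "B = (\<lambda>y :: int. {x :: int. S\<^sub>0 \<le> x \<and>
    h * (1 + t\<^sub>1) \<le> x\<^sup>2 - a * y\<^sup>2 - w t\<^sub>1 \<and> x\<^sup>2 - a * y\<^sup>2 - w t\<^sub>1 \<le> 2 * (h * (1 + t\<^sub>1))})"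
  \<comment> \<open>Here \<open>c 1\<close> is eliminated: the value at \<open>t\<^sub>1\<close>
    expresses \<open>t\<^sub>1 * c 1\<close> through \<open>c\<^sub>0\<close>, so the equation at
    \<open>t\<^sub>2\<close> is multiplied by \<open>t\<^sub>1\<close> to stay in the
    integers.\<close>
  define D where "D = (\<lambda>y x y' :: int. {z :: int. S\<^sub>0 \<le> z \<and> (\<exists>c\<^sub>0\<in>{h..<2 * h}.
    t\<^sub>1 * (z\<^sup>2 - a * y'\<^sup>2 - w t\<^sub>2) = t\<^sub>1 * c\<^sub>0 + t\<^sub>2 * (x\<^sup>2 - a * y\<^sup>2 - w t\<^sub>1 - c\<^sub>0))})"
  define \<beta> where "\<beta> = real_of_int (2 * (h * T)) / (2 * S\<^sub>0)"
  define \<delta> where "\<delta> = real_of_int (q * h) / T / (2 * S\<^sub>0)"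
  have nn: "\<beta> \<ge> 0" "\<delta> \<ge> 0" using h_pos T1 S0_pos q by (auto simp: \<beta>_def \<delta>_def)
  have A: "real_of_int (y - y') \<le> S\<^sub>0" if "y \<in> {1..Y}" "y' \<in> {1..Y}" for y y'
  proof -
    have "y - y' \<le> Y" using that by auto
    then show ?thesis using Y_le_S0 by linarith
  qed
  have B: "real_of_int (x - x') \<le> \<beta>" if "x \<in> B y" "x' \<in> B y" for x x' y
    unfolding \<beta>_def
  proof (rule diff_le_of_squares_diff_le[OF S0_pos])
    have "x\<^sup>2 - x'\<^sup>2 \<le> h * (1 + t\<^sub>1)" using that by (auto simp: B_def)
    also have "\<dots> \<le> h * (2 * T)" using h_pos t by (intro mult_left_mono) auto
    finally show "real_of_int (x\<^sup>2 - x'\<^sup>2) \<le> real_of_int (2 * (h * T))"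
      by (simp only: of_int_le_iff mult.left_commute)
  qed (use that h_pos T1 in \<open>auto simp: B_def\<close>)
  have D: "real_of_int (z - z') \<le> \<delta>" if z: "z \<in> D y x y'" "z' \<in> D y x y'" for z z' y x y'
    unfolding \<delta>_def
  proof (rule diff_le_of_squares_diff_le[OF S0_pos])
    obtain c c' where c: "c \<in> {h..<2 * h}" "c' \<in> {h..<2 * h}"
      "t\<^sub>1 * (z\<^sup>2 - a * y'\<^sup>2 - w t\<^sub>2) = t\<^sub>1 * c + t\<^sub>2 * (x\<^sup>2 - a * y\<^sup>2 - w t\<^sub>1 - c)"
      "t\<^sub>1 * (z'\<^sup>2 - a * y'\<^sup>2 - w t\<^sub>2) = t\<^sub>1 * c' + t\<^sub>2 * (x\<^sup>2 - a * y\<^sup>2 - w t\<^sub>1 - c')"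
      using z unfolding D_def by blast
    have "t\<^sub>1 * (z\<^sup>2 - z'\<^sup>2) = t\<^sub>1 * (z\<^sup>2 - a * y'\<^sup>2 - w t\<^sub>2) - t\<^sub>1 * (z'\<^sup>2 - a * y'\<^sup>2 - w t\<^sub>2)"
      by (simp add: algebra_simps)
    \<comment> \<open>For given \<open>x\<close>, \<open>y\<close> and \<open>y'\<close> only the
      constant coefficient varies, and it enters with the factor
      \<open>t\<^sub>1 - t\<^sub>2\<close>; this is the source of \<open>q\<close> in
      \<open>\<delta>\<close>.\<close>
    also have "\<dots> = (t\<^sub>1 - t\<^sub>2) * (c - c')" unfolding c by (simp add: algebra_simps)
    also have "\<dots> \<le> \<bar>t\<^sub>1 - t\<^sub>2\<bar> * \<bar>c - c'\<bar>" by (metis abs_ge_self abs_mult)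
    also have "\<dots> \<le> q * h" unfolding q_def using c by (intro mult_left_mono) auto
    finally have le: "real_of_int (t\<^sub>1 * (z\<^sup>2 - z'\<^sup>2)) \<le> real_of_int (q * h)" by (simp only: of_int_le_iff)
    show "real_of_int (z\<^sup>2 - z'\<^sup>2) \<le> real_of_int (q * h) / T"
    proof (cases "z\<^sup>2 - z'\<^sup>2 \<ge> 0")
      case True
      then have "T * (z\<^sup>2 - z'\<^sup>2) \<le> t\<^sub>1 * (z\<^sup>2 - z'\<^sup>2)" using t by (intro mult_right_mono) auto
      then have "real_of_int (T * (z\<^sup>2 - z'\<^sup>2)) \<le> real_of_int (t\<^sub>1 * (z\<^sup>2 - z'\<^sup>2))" by (simp only: of_int_le_iff)
      then have "real_of_int (z\<^sup>2 - z'\<^sup>2) * T \<le> real_of_int (q * h)"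
        using le by (simp only: of_int_mult mult.commute)
      then show ?thesis using T1 by (simp add: pos_le_divide_eq)
    next
      case False
      then have "real_of_int (z\<^sup>2 - z'\<^sup>2) \<le> 0" by (simp only: of_int_le_0_iff)
      also have "0 \<le> real_of_int (q * h) / T" using q h_pos T1 by simp
      finally show ?thesis .
    qed
  qed (use that q h_pos T1 in \<open>auto simp: D_def\<close>)
  have Q: "y\<^sub>1 \<in> {1..Y} \<and> x\<^sub>1 \<in> B y\<^sub>1 \<and> y\<^sub>2 \<in> {1..Y} \<and> x\<^sub>2 \<in> D y\<^sub>1 x\<^sub>1 y\<^sub>2 \<and>
      (x\<^sub>1 mod q, y\<^sub>1 mod q, x\<^sub>2 mod q, y\<^sub>2 mod q) \<in> residue_quadruples a q"
    if mem: "(x\<^sub>1, y\<^sub>1, x\<^sub>2, y\<^sub>2) \<in> tail_sols t\<^sub>1 t\<^sub>2 g" for x\<^sub>1 y\<^sub>1 x\<^sub>2 y\<^sub>2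
  proof -
    obtain c where c: "c \<in> coeff_box" "restrict c {2..d} = g" "(x\<^sub>1, y\<^sub>1) \<in> sols c t\<^sub>1" "(x\<^sub>2, y\<^sub>2) \<in> sols c t\<^sub>2"
      using mem by (auto simp: tail_sols_def)
    note b1 = sols_bounds[OF c(1) t(1) c(3)] and b2 = sols_bounds[OF c(1) t(2) c(4)]
    have v1: "x\<^sub>1\<^sup>2 - a * y\<^sub>1\<^sup>2 - w t\<^sub>1 = c 0 + c 1 * t\<^sub>1"
      using b1(5) val_split[of c t\<^sub>1] unfolding c(2) by (simp add: w_def)
    have v2: "x\<^sub>2\<^sup>2 - a * y\<^sub>2\<^sup>2 - w t\<^sub>2 = c 0 + c 1 * t\<^sub>2"
      using b2(5) val_split[of c t\<^sub>2] unfolding c(2) by (simp add: w_def)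
    have c0: "h \<le> c 0" "c 0 < 2 * h" and c1: "h \<le> c 1" "c 1 < 2 * h"
      using coeff_box_bounds[OF c(1), of 0] coeff_box_bounds[OF c(1), of 1] d0 by auto
    have t1: "t\<^sub>1 \<ge> 0" using t T1 by auto
    have "h * t\<^sub>1 \<le> c 1 * t\<^sub>1" "c 1 * t\<^sub>1 \<le> 2 * h * t\<^sub>1"
      using c1 t1 by (auto intro!: mult_right_mono)
    then have "h * (1 + t\<^sub>1) \<le> c 0 + c 1 * t\<^sub>1" "c 0 + c 1 * t\<^sub>1 \<le> 2 * (h * (1 + t\<^sub>1))"
      using c0 by (auto simp: algebra_simps)
    then have "x\<^sub>1 \<in> B y\<^sub>1" using b1(1) unfolding B_def mem_Collect_eq v1 by simp
    moreover have "x\<^sub>2 \<in> D y\<^sub>1 x\<^sub>1 y\<^sub>2"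
      unfolding D_def mem_Collect_eq v1 v2 using b2(1) c0
      by (intro conjI bexI[of _ "c 0"]) (auto simp: algebra_simps)
    moreover have qdvd: "q dvd (x\<^sub>1\<^sup>2 - a * y\<^sub>1\<^sup>2) - (x\<^sub>2\<^sup>2 - a * y\<^sub>2\<^sup>2)"
      unfolding b1(5) b2(5) q_def using diff_dvd_val_diff by simp
    have dv: "q dvd (z mod q)\<^sup>2 - z\<^sup>2" for z
      by (simp add: mod_eq_dvd_iff[symmetric] power_mod)
    have "((x\<^sub>1 mod q)\<^sup>2 - a * (y\<^sub>1 mod q)\<^sup>2) - ((x\<^sub>2 mod q)\<^sup>2 - a * (y\<^sub>2 mod q)\<^sup>2) =
      ((x\<^sub>1\<^sup>2 - a * y\<^sub>1\<^sup>2) - (x\<^sub>2\<^sup>2 - a * y\<^sub>2\<^sup>2)) + ((x\<^sub>1 mod q)\<^sup>2 - x\<^sub>1\<^sup>2) - a * ((y\<^sub>1 mod q)\<^sup>2 - y\<^sub>1\<^sup>2)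
      - ((x\<^sub>2 mod q)\<^sup>2 - x\<^sub>2\<^sup>2) + a * ((y\<^sub>2 mod q)\<^sup>2 - y\<^sub>2\<^sup>2)"
      by (simp add: algebra_simps)
    then have "q dvd ((x\<^sub>1 mod q)\<^sup>2 - a * (y\<^sub>1 mod q)\<^sup>2) - ((x\<^sub>2 mod q)\<^sup>2 - a * (y\<^sub>2 mod q)\<^sup>2)"
      by (simp only:) (intro dvd_add dvd_diff qdvd dvd_mult dv)
    then have "(x\<^sub>1 mod q, y\<^sub>1 mod q, x\<^sub>2 mod q, y\<^sub>2 mod q) \<in> residue_quadruples a q"
      using q by (simp add: residue_quadruples_def)
    ultimately show ?thesis using b1(4) b2(4) by simp
  qed
  have S0n: "S\<^sub>0 \<ge> 0" using S0_pos by simp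
  have main: "finite (tail_sols t\<^sub>1 t\<^sub>2 g)" "real (card (tail_sols t\<^sub>1 t\<^sub>2 g)) \<le> card (residue_quadruples a q) *
      ((S\<^sub>0 / q + 1) * ((\<beta> / q + 1) * ((S\<^sub>0 / q + 1) * (\<delta> / q + 1))))"
    by (rule card_quadruples_by_residues_le[of q "residue_quadruples a q" "{1..Y}" S\<^sub>0 B \<beta> D \<delta>];
        use q(1) finite_residue_quadruples A S0n B nn D Q in blast)+
  show "finite (tail_sols t\<^sub>1 t\<^sub>2 g)" by (rule main(1))
  have rq: "real_of_int q > 0" "real_of_int T > 0" "real_of_int h > 0" using q T1 h_pos by auto
  \<comment> \<open>Each summand 1 is absorbed by doubling, through
    \<open>q \<le> S\<^sub>0\<close>, \<open>S\<^sub>0 * q \<le> h * T\<close> and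
    \<open>2 * T * S\<^sub>0 \<le> h\<close>. The product \<open>8 * h^2 / q^3\<close> then cancels
    the \<open>q^3\<close> of the residue count.\<close>
  have "(S\<^sub>0 / q + 1) * ((\<beta> / q + 1) * ((S\<^sub>0 / q + 1) * (\<delta> / q + 1)))
    \<le> (2 * S\<^sub>0 / q) * ((2 * h * T / (S\<^sub>0 * q)) * ((2 * S\<^sub>0 / q) * (h / (T * S\<^sub>0))))"
  proof (intro mult_mono)
    have "q \<le> S\<^sub>0" using q(2) T_le_S0 by linarith
    then show 1: "S\<^sub>0 / q + 1 \<le> 2 * S\<^sub>0 / q" "S\<^sub>0 / q + 1 \<le> 2 * S\<^sub>0 / q" using rq by (auto simp: field_simps)
    have "S\<^sub>0 * q \<le> S\<^sub>0 * T" using q S0_pos by (intro mult_left_mono) auto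
    also have "\<dots> \<le> 2 * T * S\<^sub>0" using S0_pos T1 by simp
    also have "\<dots> \<le> real_of_int h * 1" using T_S0_le by simp
    also have "\<dots> \<le> h * real_of_int T" using h_pos T1 by (intro mult_left_mono) auto
    finally show "\<beta> / q + 1 \<le> 2 * h * T / (S\<^sub>0 * q)"
      using rq S0_pos by (simp add: \<beta>_def field_simps)
    show "\<delta> / q + 1 \<le> h / (T * S\<^sub>0)"
      using rq S0_pos T_S0_le by (simp add: \<delta>_def field_simps)
  qed (use rq S0_pos nn in auto)
  also have "\<dots> = 8 * h\<^sup>2 / q ^ 3"
    using rq S0_pos by (simp add: field_simps power2_eq_square power3_eq_cube)
  finally have *: "(S\<^sub>0 / q + 1) * ((\<beta> / q + 1) * ((S\<^sub>0 / q + 1) * (\<delta> / q + 1))) \<le> 8 * h\<^sup>2 / q ^ 3" .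
  have "real (card (tail_sols t\<^sub>1 t\<^sub>2 g)) \<le> real (card (residue_quadruples a q)) * (8 * h\<^sup>2 / q ^ 3)"
    using main(2) mult_left_mono[OF *, of "real (card (residue_quadruples a q))"] by linarith
  also have "\<dots> \<le> (2 * \<bar>a\<bar> * q ^ 3 * inverse_divisor_sum q) * (8 * h\<^sup>2 / q ^ 3)"
    using card_residue_quadruples_le[OF a0 q(1)] rq by (intro mult_right_mono) auto
  also have "\<dots> = 16 * \<bar>a\<bar> * h\<^sup>2 * inverse_divisor_sum q" using rq by simp
  finally show "real (card (tail_sols t\<^sub>1 t\<^sub>2 g)) \<le> 16 * \<bar>a\<bar> * h\<^sup>2 * inverse_divisor_sum \<bar>t\<^sub>1 - t\<^sub>2\<bar>"
    by (simp add: q_def)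
qed

lemma inverse_divisor_sum_nonneg: "inverse_divisor_sum q \<ge> 0"
  by (auto simp: inverse_divisor_sum_def intro!: sum_nonneg)

text \<open>Passing to the tail and the four variables is injective, as the values at
  \<open>t\<^sub>1 \<noteq> t\<^sub>2\<close> recover \<open>c 1\<close> and then
  \<open>c 0\<close>. The \<open>h ^ (d - 1)\<close> tails and the factor \<open>h^2\<close> of
  \<open>card_tail_sols_le\<close> give \<open>h ^ (d + 1)\<close>.\<close>

lemma off_diagonal_second_moment:
  assumes t: "t\<^sub>1 \<in> {T..<2 * T}" "t\<^sub>2 \<in> {T..<2 * T}" "t\<^sub>1 \<noteq> t\<^sub>2"
  shows "(\<Sum>c\<in>coeff_box. real (card (sols c t\<^sub>1 \<times> sols c t\<^sub>2))) \<le>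
    16 * \<bar>a\<bar> * h ^ (d + 1) * inverse_divisor_sum \<bar>t\<^sub>1 - t\<^sub>2\<bar>"
proof -
  define G where "G = {2..d} \<rightarrow>\<^sub>E {h..<2 * h}"
  define f where "f = (\<lambda>(c :: nat \<Rightarrow> int, (x\<^sub>1 :: int, y\<^sub>1 :: int), (x\<^sub>2 :: int, y\<^sub>2 :: int)). (restrict c {2..d}, (x\<^sub>1, y\<^sub>1, x\<^sub>2, y\<^sub>2)))"
  have finG: "finite G" by (auto simp: G_def intro!: finite_PiE)
  note ts = card_tail_sols_le[OF t]
  have "(\<Sum>c\<in>coeff_box. card (sols c t\<^sub>1 \<times> sols c t\<^sub>2)) = card (SIGMA c:coeff_box. sols c t\<^sub>1 \<times> sols c t\<^sub>2)"
    using finite_coeff_box finite_sols[OF _ t(1)] finite_sols[OF _ t(2)] by (subst card_SigmaI) auto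
  also have "\<dots> \<le> card (SIGMA g:G. tail_sols t\<^sub>1 t\<^sub>2 g)"
  proof (rule card_inj_on_le)
    show "inj_on f (SIGMA c:coeff_box. sols c t\<^sub>1 \<times> sols c t\<^sub>2)"
    proof (rule inj_onI)
      fix p p' assume pp: "p \<in> (SIGMA c:coeff_box. sols c t\<^sub>1 \<times> sols c t\<^sub>2)"
        "p' \<in> (SIGMA c:coeff_box. sols c t\<^sub>1 \<times> sols c t\<^sub>2)" "f p = f p'"
      obtain c x\<^sub>1 y\<^sub>1 x\<^sub>2 y\<^sub>2 where p: "p = (c, (x\<^sub>1, y\<^sub>1), (x\<^sub>2, y\<^sub>2))" by (cases p) auto
      obtain c' x\<^sub>1' y\<^sub>1' x\<^sub>2' y\<^sub>2' where p': "p' = (c', (x\<^sub>1', y\<^sub>1'), (x\<^sub>2', y\<^sub>2'))" by (cases p') auto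
      have eq: "restrict c {2..d} = restrict c' {2..d}" "x\<^sub>1 = x\<^sub>1'" "y\<^sub>1 = y\<^sub>1'" "x\<^sub>2 = x\<^sub>2'" "y\<^sub>2 = y\<^sub>2'"
        using pp(3) by (auto simp: p p' f_def)
      have cc: "c \<in> coeff_box" "c' \<in> coeff_box" using pp by (auto simp: p p')
      have "val c t\<^sub>1 = val c' t\<^sub>1" "val c t\<^sub>2 = val c' t\<^sub>2"
        using pp(1,2) eq(2-) by (auto simp: p p' sols_def)
      then have 1: "c 0 + c 1 * t\<^sub>1 = c' 0 + c' 1 * t\<^sub>1" and 2: "c 0 + c 1 * t\<^sub>2 = c' 0 + c' 1 * t\<^sub>2"
        unfolding val_split eq(1) by auto
      then have "(c 1 - c' 1) * (t\<^sub>1 - t\<^sub>2) = 0" by (simp add: algebra_simps)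
      then have c1: "c 1 = c' 1" using t(3) by simp
      then have c0: "c 0 = c' 0" using 1 by simp
      have "c = c'"
      proof (rule coeff_box_eqI[OF cc])
        fix i assume "i \<le> d"
        then have "i = 0 \<or> i = 1 \<or> i \<in> {2..d}" by auto
        then show "c i = c' i" using c0 c1 eq(1) by (metis restrict_apply')
      qed
      then show "p = p'" using eq by (simp add: p p')
    qed
    show "f ` (SIGMA c:coeff_box. sols c t\<^sub>1 \<times> sols c t\<^sub>2) \<subseteq> (SIGMA g:G. tail_sols t\<^sub>1 t\<^sub>2 g)"
    proof
      fix r assume "r \<in> f ` (SIGMA c:coeff_box. sols c t\<^sub>1 \<times> sols c t\<^sub>2)"
      then obtain c x\<^sub>1 y\<^sub>1 x\<^sub>2 y\<^sub>2 where c: "c \<in> coeff_box" "(x\<^sub>1, y\<^sub>1) \<in> sols c t\<^sub>1" "(x\<^sub>2, y\<^sub>2) \<in> sols c t\<^sub>2"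
        "r = f (c, (x\<^sub>1, y\<^sub>1), (x\<^sub>2, y\<^sub>2))" by auto
      have "restrict c {2..d} \<in> G" using coeff_box_bounds[OF c(1)] by (auto simp: G_def)
      moreover have "(x\<^sub>1, y\<^sub>1, x\<^sub>2, y\<^sub>2) \<in> tail_sols t\<^sub>1 t\<^sub>2 (restrict c {2..d})"
        using c(1-3) by (auto simp: tail_sols_def)
      ultimately show "r \<in> (SIGMA g:G. tail_sols t\<^sub>1 t\<^sub>2 g)" by (simp add: c(4) f_def)
    qed
    show "finite (SIGMA g:G. tail_sols t\<^sub>1 t\<^sub>2 g)" using finG ts by auto
  qed
  finally have "(\<Sum>c\<in>coeff_box. real (card (sols c t\<^sub>1 \<times> sols c t\<^sub>2))) \<le> real (card (SIGMA g:G. tail_sols t\<^sub>1 t\<^sub>2 g))"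
    by (simp only: of_nat_le_iff flip: of_nat_sum)
  also have "\<dots> \<le> real (card G) * (16 * \<bar>a\<bar> * h\<^sup>2 * inverse_divisor_sum \<bar>t\<^sub>1 - t\<^sub>2\<bar>)"
    using finG ts inverse_divisor_sum_nonneg by (intro card_Sigma_le) auto
  also have "real (card G) = h ^ (d - 1)" unfolding G_def using card_box[of "{2..d}"] by simp
  also have "h ^ (d - 1) * (16 * \<bar>a\<bar> * h\<^sup>2 * inverse_divisor_sum \<bar>t\<^sub>1 - t\<^sub>2\<bar>) =
    16 * \<bar>a\<bar> * h ^ (d + 1) * inverse_divisor_sum \<bar>t\<^sub>1 - t\<^sub>2\<bar>"
    using d0 by (cases d) (auto simp: power2_eq_square)
  finally show ?thesis .
qed

text \<open>On either side of \<open>t\<close> each distance occurs at most once and is at most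
  \<open>T\<close>, so \<open>sum_inverse_divisor_sum_le\<close> applies twice.\<close>

lemma sum_inverse_divisor_sum_dist_le:
  assumes "t \<in> {T..<2 * T}"
  shows "(\<Sum>s\<in>{T..<2 * T} - {t}. inverse_divisor_sum \<bar>t - s\<bar>) \<le> 4 * T"
proof -
  have eq: "{T..<2 * T} - {t} = {T..<t} \<union> {t<..<2 * T}" using assms by auto
  have "(\<Sum>s\<in>{T..<2 * T} - {t}. inverse_divisor_sum \<bar>t - s\<bar>) =
      (\<Sum>s\<in>{T..<t}. inverse_divisor_sum \<bar>t - s\<bar>) + (\<Sum>s\<in>{t<..<2 * T}. inverse_divisor_sum \<bar>t - s\<bar>)"
    unfolding eq by (rule sum.union_disjoint) auto
  also have "(\<Sum>s\<in>{T..<t}. inverse_divisor_sum \<bar>t - s\<bar>) = (\<Sum>q\<in>{1..t - T}. inverse_divisor_sum q)"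
    by (rule sum.reindex_bij_witness[of _ "\<lambda>q. t - q" "\<lambda>s. t - s"]) auto
  also have "\<dots> \<le> (\<Sum>q\<in>{1..T}. inverse_divisor_sum q)"
    using assms inverse_divisor_sum_nonneg by (intro sum_mono2) auto
  also have "(\<Sum>s\<in>{t<..<2 * T}. inverse_divisor_sum \<bar>t - s\<bar>) = (\<Sum>q\<in>{1..<2 * T - t}. inverse_divisor_sum q)"
    by (rule sum.reindex_bij_witness[of _ "\<lambda>q. t + q" "\<lambda>s. s - t"]) auto
  also have "\<dots> \<le> (\<Sum>q\<in>{1..T}. inverse_divisor_sum q)"
    using assms inverse_divisor_sum_nonneg by (intro sum_mono2) auto
  finally show ?thesis using sum_inverse_divisor_sum_le[of T] T1 by simp
qed

section \<open>Full second moment and the Cauchy-Schwarz inequality\<close>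

text \<open>The square expands over pairs \<open>(t, s)\<close>. Each \<open>t\<close> contributes
  order \<open>h ^ (d + 1) * T\<close> from \<open>s = t\<close>, and the same order from all
  \<open>s \<noteq> t\<close> together; \<open>578 = 514 + 16 * 4\<close>.\<close>

lemma second_moment:
  "(\<Sum>c\<in>coeff_box. (\<Sum>t\<in>{T..<2 * T}. real (card (sols c t)))\<^sup>2)
    \<le> 578 * a\<^sup>2 * value_const d * h ^ (d + 1) * T\<^sup>2"
proof -
  let ?I = "{T..<2 * T}"
  have "(\<Sum>c\<in>coeff_box. (\<Sum>t\<in>?I. real (card (sols c t)))\<^sup>2) =
      (\<Sum>c\<in>coeff_box. \<Sum>t\<in>?I. \<Sum>s\<in>?I. real (card (sols c t \<times> sols c s)))"
    by (simp add: power2_eq_square sum_product card_cartesian_product)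
  also have "\<dots> = (\<Sum>t\<in>?I. \<Sum>c\<in>coeff_box. \<Sum>s\<in>?I. real (card (sols c t \<times> sols c s)))"
    by (rule sum.swap)
  also have "\<dots> = (\<Sum>t\<in>?I. \<Sum>s\<in>?I. \<Sum>c\<in>coeff_box. real (card (sols c t \<times> sols c s)))"
    by (intro sum.cong refl sum.swap)
  also have "\<dots> \<le> (\<Sum>t\<in>?I. real_of_int (578 * a\<^sup>2 * value_const d * h ^ (d + 1) * T))"
  proof (rule sum_mono)
    fix t assume t: "t \<in> ?I"
    have "(\<Sum>s\<in>?I. \<Sum>c\<in>coeff_box. real (card (sols c t \<times> sols c s))) =
      (\<Sum>c\<in>coeff_box. real (card (sols c t \<times> sols c t))) +
      (\<Sum>s\<in>?I - {t}. \<Sum>c\<in>coeff_box. real (card (sols c t \<times> sols c s)))"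
      using t by (intro sum.remove) auto
    also have "\<dots> \<le> 514 * a\<^sup>2 * value_const d * h ^ (d + 1) * T +
      (\<Sum>s\<in>?I - {t}. 16 * \<bar>a\<bar> * h ^ (d + 1) * inverse_divisor_sum \<bar>t - s\<bar>)"
      using t by (intro add_mono diagonal_second_moment sum_mono off_diagonal_second_moment) auto
    also have "(\<Sum>s\<in>?I - {t}. 16 * \<bar>a\<bar> * h ^ (d + 1) * inverse_divisor_sum \<bar>t - s\<bar>) =
       16 * \<bar>a\<bar> * h ^ (d + 1) * (\<Sum>s\<in>?I - {t}. inverse_divisor_sum \<bar>t - s\<bar>)"
      by (simp add: sum_distrib_left)
    also have "\<dots> \<le> 16 * \<bar>a\<bar> * h ^ (d + 1) * real_of_int (4 * T)"
      using sum_inverse_divisor_sum_dist_le[OF t] h_pos by (intro mult_left_mono) auto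
    also have "\<dots> \<le> 64 * a\<^sup>2 * value_const d * h ^ (d + 1) * T"
    proof -
      have "\<bar>a\<bar> * 1 \<le> a\<^sup>2 * value_const d"
        using a_sq value_const_ge[of d] by (intro mult_mono) auto
      then have "\<bar>a\<bar> * (64 * h ^ (d + 1) * T) \<le> (a\<^sup>2 * value_const d) * (64 * h ^ (d + 1) * T)"
        using h_pos T1 by (intro mult_right_mono) auto
      then have "real_of_int (\<bar>a\<bar> * (64 * h ^ (d + 1) * T)) \<le> real_of_int ((a\<^sup>2 * value_const d) * (64 * h ^ (d + 1) * T))"
        by (simp only: of_int_le_iff)
      then show ?thesis by (simp add: mult_ac)
    qed
    finally show "(\<Sum>s\<in>?I. \<Sum>c\<in>coeff_box. real (card (sols c t \<times> sols c s))) \<le>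
      578 * a\<^sup>2 * value_const d * h ^ (d + 1) * T" by (simp add: algebra_simps)
  qed
  also have "\<dots> = 578 * a\<^sup>2 * value_const d * h ^ (d + 1) * T\<^sup>2"
    using T1 by (simp add: power2_eq_square)
  finally show ?thesis .
qed

text \<open>By Cauchy-Schwarz on the support \<open>Z\<close> of \<open>n\<close>, the squared first
  moment is at most \<open>card Z\<close> times the second moment, and both carry the factor
  \<open>T^2\<close>. The constant is \<open>578 * 64 * 2\<close>; \<open>|a| ^ 3\<close> combines
  \<open>a^2\<close> from the second moment with \<open>|a|\<close> from the squared first.\<close>

lemma card_represented_ge:
  "h ^ (d + 1) / (73984 * \<bar>a\<bar> ^ 3 * (value_const d)\<^sup>2) \<le>
    real (card {c \<in> coeff_box. \<exists>t\<in>{T..<2 * T}. sols c t \<noteq> {}})"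
proof -
  let ?I = "{T..<2 * T}"
  define n where "n = (\<lambda>c. \<Sum>t\<in>?I. real (card (sols c t)))"
  define Z where "Z = {c \<in> coeff_box. \<exists>t\<in>?I. sols c t \<noteq> {}}"
  have Z: "finite Z" "Z \<subseteq> coeff_box" using finite_coeff_box by (auto simp: Z_def)
  define k where "k = 2 * real_of_int \<bar>a\<bar> * value_const d"
  have k: "k > 0" using a_sq value_const_ge[of d] by (simp add: k_def)
  define H where "H = real_of_int h ^ (d + 1)"
  have H: "H > 0" using h_pos by (simp add: H_def)
  have T: "real_of_int T > 0" using T1 by simp
  have sq: "(T * (H / (8 * sqrt k)))\<^sup>2 = T\<^sup>2 * H * (H / (64 * k))"
    using k by (simp add: power_mult_distrib power_divide) (simp add: power2_eq_square)
  have "T * (H / (8 * sqrt k)) = (\<Sum>t\<in>?I. H / (8 * sqrt k))" using T1 by simp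
  also have "\<dots> \<le> (\<Sum>t\<in>?I. \<Sum>c\<in>coeff_box. real (card (sols c t)))"
    using first_moment by (intro sum_mono) (simp add: H_def k_def)
  also have "\<dots> = (\<Sum>c\<in>coeff_box. n c)" unfolding n_def by (rule sum.swap)
  also have "\<dots> = (\<Sum>c\<in>Z. 1 * n c)"
    using finite_coeff_box Z by (intro sum.mono_neutral_cong_right) (auto simp: Z_def n_def)
  finally have "(T * (H / (8 * sqrt k)))\<^sup>2 \<le> (\<Sum>c\<in>Z. 1 * n c)\<^sup>2"
    using T H k by (intro power_mono) auto
  also have "\<dots> \<le> (\<Sum>c\<in>Z. 1\<^sup>2) * (\<Sum>c\<in>Z. (n c)\<^sup>2)" by (rule Cauchy_Schwarz_ineq_sum)
  also have "\<dots> \<le> real (card Z) * (\<Sum>c\<in>coeff_box. (n c)\<^sup>2)"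
    using Z finite_coeff_box by (auto intro!: mult_left_mono sum_mono2)
  also have "\<dots> \<le> real (card Z) * (578 * a\<^sup>2 * value_const d * H * T\<^sup>2)"
    using second_moment by (intro mult_left_mono) (auto simp: n_def H_def)
  finally have "T\<^sup>2 * H * (H / (64 * k)) \<le> T\<^sup>2 * H * (real (card Z) * (578 * a\<^sup>2 * value_const d))"
    unfolding sq by (simp only: mult_ac)
  then have "H / (64 * k) \<le> real (card Z) * (578 * a\<^sup>2 * value_const d)"
    by (rule mult_left_le_imp_le) (use T H in simp)
  then have "H \<le> real (card Z) * (578 * a\<^sup>2 * value_const d) * (64 * k)"
    using k by (simp add: pos_divide_le_eq)
  also have "\<dots> = real (card Z) * (73984 * \<bar>a\<bar> ^ 3 * (value_const d)\<^sup>2)"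
    by (simp add: k_def power2_eq_square power3_eq_cube mult_ac)
  finally have "H / (73984 * \<bar>a\<bar> ^ 3 * (value_const d)\<^sup>2) \<le> real (card Z)"
    using a_sq value_const_ge[of d] by (subst pos_divide_le_eq) (auto intro!: mult_pos_pos)
  then show ?thesis by (simp add: H_def Z_def)
qed

end

section \<open>From coefficient vectors to polynomials of bounded height\<close>

lemma card_polys_of_height_at_most_le:
  "card (polys_of_height_at_most d H) \<le> (2 * H + 1) ^ (d + 1)"
proof -
  define f where "f = (\<lambda>P :: int poly. restrict (coeff P) {..d})"
  have "card (polys_of_height_at_most d H) \<le> card ({..d} \<rightarrow>\<^sub>E {- int H..int H})"
  proof (rule card_inj_on_le)
    show "inj_on f (polys_of_height_at_most d H)"
    proof (rule inj_onI)
      fix P Q assume PQ: "P \<in> polys_of_height_at_most d H" "Q \<in> polys_of_height_at_most d H" "f P = f Q"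
      show "P = Q"
      proof (rule poly_eqI)
        fix i show "coeff P i = coeff Q i"
        proof (cases "i \<le> d")
          case True
          then show ?thesis using PQ(3) unfolding f_def by (metis atMost_iff restrict_apply')
        next
          case False
          then show ?thesis using PQ by (simp add: polys_of_height_at_most_def coeff_eq_0)
        qed
      qed
    qed
    show "f ` polys_of_height_at_most d H \<subseteq> {..d} \<rightarrow>\<^sub>E {- int H..int H}"
    proof
      fix r assume "r \<in> f ` polys_of_height_at_most d H"
      then obtain P where P: "degree P = d" "height P \<le> int H" "r = f P"
        by (auto simp: polys_of_height_at_most_def)
      have "coeff P i \<in> {- int H..int H}" if "i \<le> d" for i
      proof -
        have "\<bar>coeff P i\<bar> \<le> height P" unfolding height_def using that P by (intro Max_ge) auto
        then show ?thesis using P(2) unfolding atLeastAtMost_iff by linarith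
      qed
      then show "r \<in> {..d} \<rightarrow>\<^sub>E {- int H..int H}" unfolding P(3) f_def by auto
    qed
    show "finite ({..d} \<rightarrow>\<^sub>E {- int H..int H})" by (intro finite_PiE) auto
  qed
  also have "\<dots> = (2 * H + 1) ^ (d + 1)" 
  proof -
    have "card {- int H..int H} = 2 * H + 1" by simp
    then show ?thesis by (subst card_funcsetE) (simp_all del: power_Suc)
  qed
  finally show ?thesis .
qed

context conic_family
begin

definition poly_of :: "(nat \<Rightarrow> int) \<Rightarrow> int poly" where
  "poly_of c = (\<Sum>i\<le>d. monom (c i) i)"

lemma coeff_poly_of: "coeff (poly_of c) i = (if i \<le> d then c i else 0)"
  by (simp add: poly_of_def coeff_sum)

lemma poly_poly_of: "poly (poly_of c) t = val c t"
  by (simp add: poly_of_def val_def poly_sum poly_monom)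

text \<open>The lower bound allows \<open>h\<close> to be replaced by the height in the size of the
  solution; the upper bound places the polynomial among those counted.\<close>

lemma poly_of_props:
  assumes "c \<in> coeff_box"
  shows "degree (poly_of c) = d" "h \<le> height (poly_of c)" "height (poly_of c) \<le> 2 * h"
proof -
  note b = coeff_box_bounds[OF assms]
  show deg: "degree (poly_of c) = d"
  proof (rule antisym)
    show "degree (poly_of c) \<le> d" by (rule degree_le) (simp add: coeff_poly_of)
    show "d \<le> degree (poly_of c)" using b[of d] h_pos by (intro le_degree) (simp add: coeff_poly_of)
  qed
  have "\<bar>coeff (poly_of c) d\<bar> \<le> height (poly_of c)" unfolding height_def deg by (intro Max_ge) auto
  then show "h \<le> height (poly_of c)" using b[of d] by (simp add: coeff_poly_of)
  show "height (poly_of c) \<le> 2 * h"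
    unfolding height_def deg
  proof (rule Max.boundedI)
    fix v assume "v \<in> (\<lambda>i. \<bar>coeff (poly_of c) i\<bar>) ` {..d}"
    then obtain i where "i \<le> d" "v = \<bar>c i\<bar>" by (auto simp: coeff_poly_of)
    then show "v \<le> 2 * h" using b[of i] h_pos by simp
  qed auto
qed

lemma inj_on_poly_of: "inj_on poly_of coeff_box"
proof (rule inj_onI)
  fix c c' assume cc: "c \<in> coeff_box" "c' \<in> coeff_box" "poly_of c = poly_of c'"
  show "c = c'"
  proof (rule coeff_box_eqI[OF cc(1,2)])
    fix i assume "i \<le> d"
    then show "c i = c' i" using coeff_poly_of[of c i] coeff_poly_of[of c' i] cc(3) by simp
  qed
qed

text \<open>All four unknowns are at most \<open>2 * S\<^sub>1\<close>, which is
  \<open>sqrt h\<close> times the left side of \<open>bound\<close>. The resulting estimate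
  \<open>sqrt h * ln h powr e\<close> only grows when \<open>h\<close> is replaced by the height,
  and \<open>|a| powr (1 / 2) \<ge> 1\<close>.\<close>

lemma card_polys_with_small_solution_ge:
  fixes e :: real
  assumes H: "2 * h \<le> int H" and e: "e \<ge> 0"
    and bound: "2 * sqrt (value_const d * T ^ d) \<le> ln h powr e"
  shows "h ^ (d + 1) / (73984 * \<bar>a\<bar> ^ 3 * (value_const d)\<^sup>2) \<le>
    real (card {P \<in> polys_of_height_at_most d H. \<exists>x y z t :: nat.
           x > 0 \<and> y > 0 \<and> z > 0 \<and> t > 0 \<and>
           (int x)\<^sup>2 - a * (int y)\<^sup>2 = poly P (int t) * (int z)\<^sup>2 \<and>
           real (Max {x, y, z, t}) \<le>
             real_of_int \<bar>a\<bar> powr (1 / 2) * real_of_int (height P) powr (1 / 2) *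
             ln (real_of_int (height P)) powr e})" (is "_ \<le> real (card ?G)")
proof -
  let ?Z = "{c \<in> coeff_box. \<exists>t\<in>{T..<2 * T}. sols c t \<noteq> {}}"
  have "card ?Z \<le> card ?G"
  proof (rule card_inj_on_le)
    show "inj_on poly_of ?Z" using inj_on_poly_of by (rule inj_on_subset) auto
    show "finite ?G" using finite_polys_of_height_at_most by simp
    show "poly_of ` ?Z \<subseteq> ?G"
    proof
      fix P assume "P \<in> poly_of ` ?Z"
      then obtain c t x y where c: "P = poly_of c" "c \<in> coeff_box" "t \<in> {T..<2 * T}" "(x, y) \<in> sols c t"
        by fast
      note pp = poly_of_props[OF c(2)] and sb = sols_bounds[OF c(2-4)]
      have "P \<in> polys_of_height_at_most d H"
        using pp H by (simp add: polys_of_height_at_most_def c(1))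
      moreover have "\<exists>x y z t :: nat.
           x > 0 \<and> y > 0 \<and> z > 0 \<and> t > 0 \<and>
           (int x)\<^sup>2 - a * (int y)\<^sup>2 = poly P (int t) * (int z)\<^sup>2 \<and>
           real (Max {x, y, z, t}) \<le>
             real_of_int \<bar>a\<bar> powr (1 / 2) * real_of_int (height P) powr (1 / 2) *
             ln (real_of_int (height P)) powr e"
      proof (rule exI[of _ "nat x"], rule exI[of _ "nat y"], rule exI[of _ 1], rule exI[of _ "nat t"], intro conjI)
        show "nat x > 0" "nat y > 0" "nat t > 0" using sb c(3) T1 by auto
        show "(int (nat x))\<^sup>2 - a * (int (nat y))\<^sup>2 = poly P (int (nat t)) * (int 1)\<^sup>2"
          using sb(3-5) c(3) T1 by (simp add: c(1) poly_poly_of)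
        have T: "T \<le> S\<^sub>1" using T_le_S0 S0_le_S1 by linarith
        have "real (nat x) \<le> 2 * S\<^sub>1" using sb(2,3) S1_pos by simp
        moreover have "real (nat y) \<le> 2 * S\<^sub>1"
        proof -
          have "real_of_int y \<le> Y" using sb(4) by simp
          then show ?thesis using sb(4) Y_le_S0 S0_le_S1 S1_pos by simp
        qed
        moreover have "real 1 \<le> 2 * S\<^sub>1" using T T1 by simp
        moreover have "real (nat t) \<le> 2 * S\<^sub>1"
        proof -
          have "real_of_int t \<le> 2 * T" using c(3) by simp
          then show ?thesis using T c(3) T1 by simp
        qed
        moreover define m where "m = Max {nat x, nat y, 1, nat t}"
        moreover have "m \<in> {nat x, nat y, 1, nat t}" unfolding m_def by (rule Max_in) auto
        ultimately have "real (Max {nat x, nat y, 1, nat t}) \<le> 2 * S\<^sub>1"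
          unfolding m_def[symmetric] by (elim insertE emptyE) (simp_all only:)
        also have "2 * S\<^sub>1 = sqrt h * (2 * sqrt (value_const d * T ^ d))"
          unfolding S\<^sub>1_def M_def by (simp add: real_sqrt_mult)
        also have "\<dots> \<le> sqrt h * ln h powr e"
          using bound h_pos by (intro mult_left_mono) auto
        also have "\<dots> \<le> sqrt (height P) * ln (height P) powr e"
          using pp(2) h_pos e
          by (intro mult_mono powr_mono2 ln_mono ln_ge_zero) (auto simp: c(1))
        also have "\<dots> \<le> real_of_int \<bar>a\<bar> powr (1 / 2) * (sqrt (height P) * ln (height P) powr e)"
        proof -
          have "1 \<le> real_of_int \<bar>a\<bar> powr (1 / 2)" using a_sq by (simp add: ge_one_powr_ge_zero)
          moreover have "sqrt (height P) * ln (height P) powr e \<ge> 0"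
            using pp(2) h_pos by (simp add: c(1))
          ultimately show ?thesis using mult_right_mono by fastforce
        qed
        also have "sqrt (height P) = real_of_int (height P) powr (1 / 2)"
          using pp(2) h_pos by (simp add: powr_half_sqrt c(1))
        finally show "real (Max {nat x, nat y, 1, nat t}) \<le>
             real_of_int \<bar>a\<bar> powr (1 / 2) * real_of_int (height P) powr (1 / 2) *
             ln (real_of_int (height P)) powr e" by (simp only: mult.assoc)
      qed simp
      ultimately show "P \<in> ?G" by blast
    qed
  qed
  then show ?thesis using card_represented_ge by linarith
qed

end

section \<open>Choice of \<open>T\<close> for large \<open>h\<close>, and the lower limit\<close>

text \<open>For large \<open>n\<close>, \<open>T n\<close> lies between \<open>ln n\<close> and
  \<open>2 * ln n\<close>, so constant multiples of its powers stay below \<open>n\<close>. The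
  exponent \<open>d / 2\<close> matches \<open>sqrt (T n ^ d)\<close>, and the surplus \<epsilon>
  absorbs the constant \<open>2 * sqrt (value_const d * 2 ^ d)\<close>.\<close>

lemma eventually_conic_family:
  fixes \<epsilon> :: real and a :: int and d :: nat
  assumes "\<epsilon> > 0" "a \<noteq> 0" "d > 0"
  defines "T \<equiv> \<lambda>n :: nat. \<lceil>ln (real n)\<rceil>"
  shows "\<forall>\<^sub>F n in sequentially. conic_family a (int n) (T n) d \<and>
    2 * sqrt (value_const d * T n ^ d) \<le> ln (real n) powr (d / 2 + \<epsilon>)"
proof -
  define K where "K = real_of_int (value_const d)"
  have K: "K \<ge> 1" using value_const_ge[of d] by (simp add: K_def)
  have poly: "\<forall>\<^sub>F n :: nat in sequentially. C * (2 * ln (real n)) ^ k \<le> real n" for C :: real and k :: nat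
  proof -
    have "((\<lambda>x :: real. x ^ k / exp x) \<longlongrightarrow> 0) at_top" by (rule tendsto_power_div_exp_0)
    moreover have "filterlim (\<lambda>n :: nat. ln (real n)) at_top sequentially" by real_asymp
    ultimately have "(\<lambda>n :: nat. ln (real n) ^ k / exp (ln (real n))) \<longlonglongrightarrow> 0"
      by (rule filterlim_compose)
    then have "(\<lambda>n :: nat. C * 2 ^ k * (ln (real n) ^ k / exp (ln (real n)))) \<longlonglongrightarrow> C * 2 ^ k * 0"
      by (intro tendsto_intros)
    then have "\<forall>\<^sub>F n :: nat in sequentially. C * 2 ^ k * (ln (real n) ^ k / exp (ln (real n))) < 1"
      by (rule order_tendstoD) simp
    then show ?thesis using eventually_gt_at_top[of 0]
      by eventually_elim (simp add: field_simps power_mult_distrib)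
  qed
  have "\<forall>\<^sub>F n :: nat in sequentially. ln (real n) \<ge> 1" by real_asymp
  moreover have "\<forall>\<^sub>F n :: nat in sequentially. 2 * sqrt (K * 2 ^ d) \<le> ln (real n) powr \<epsilon>"
  proof -
    have "filterlim (\<lambda>n :: nat. ln (real n) powr \<epsilon>) at_top sequentially"
      using assms(1) by real_asymp
    then show ?thesis by (simp add: filterlim_at_top)
  qed
  ultimately show ?thesis
    \<comment> \<open>The three instances supply \<open>big1\<close>, \<open>big2\<close> and
      \<open>big3\<close>, in this order.\<close>
    using poly[of "16 * real_of_int (a\<^sup>2) * K" d] poly[of 2 "d + 2"] poly[of "2 ^ d" d]
  proof eventually_elim
    case (elim n)
    have T: "ln (real n) \<le> T n" "real_of_int (T n) \<le> 2 * ln (real n)" "T n \<ge> 1"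
      using elim(1) unfolding T_def by linarith+
    have Tk: "real_of_int (T n ^ k) \<le> (2 * ln (real n)) ^ k" for k
      using T unfolding of_int_power by (intro power_mono) auto
    have scaled: "C * T n ^ k \<le> int n" if "real_of_int C * (2 * ln (real n)) ^ k \<le> real n" "C \<ge> 0" for C k
    proof -
      have "real_of_int C * real_of_int (T n ^ k) \<le> real_of_int C * (2 * ln (real n)) ^ k"
        using that Tk by (intro mult_left_mono) auto
      then have "real_of_int (C * T n ^ k) \<le> real_of_int (int n)" using that by simp
      then show ?thesis by (simp only: of_int_le_iff)
    qed
    have "conic_family a (int n) (T n) d"
    proof
      show "16 * a\<^sup>2 * value_const d * T n ^ d \<le> int n"
        using elim(3) value_const_ge[of d] by (intro scaled) (auto simp: K_def)
      show "2 * T n ^ (d + 2) \<le> int n" using elim(4) by (intro scaled) auto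
      have "2 ^ d * T n ^ d \<le> int n" using elim(5) by (intro scaled) auto
      then show "(2 * T n) ^ d \<le> int n" by (simp add: power_mult_distrib)
    qed (use assms T in auto)
    moreover have "2 * sqrt (value_const d * T n ^ d) \<le> ln (real n) powr (d / 2 + \<epsilon>)"
    proof -
      have "sqrt (value_const d * T n ^ d) \<le> sqrt (K * 2 ^ d * ln (real n) ^ d)"
        using Tk[of d] K
        by (intro real_sqrt_le_mono) (simp add: K_def power_mult_distrib mult.assoc mult_left_mono)
      also have "\<dots> = sqrt (K * 2 ^ d) * ln (real n) powr (d / 2)"
        using elim(1) K by (simp add: real_sqrt_mult powr_half_sqrt[symmetric] powr_realpow[symmetric] powr_powr)
      finally have "2 * sqrt (value_const d * T n ^ d) \<le> (2 * sqrt (K * 2 ^ d)) * ln (real n) powr (d / 2)"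
        by simp
      also have "\<dots> \<le> ln (real n) powr \<epsilon> * ln (real n) powr (d / 2)"
        using elim(2) by (intro mult_right_mono) auto
      also have "\<dots> = ln (real n) powr (d / 2 + \<epsilon>)" by (simp add: powr_add)
      finally show ?thesis .
    qed
    ultimately show ?case by blast
  qed
qed

theorem corollary1p7:
  fixes \<epsilon> :: real and a :: int and d :: nat
  assumes "\<epsilon> > 0" and "a \<noteq> 0" and "d > 0"
  shows "positive_proportion d (\<lambda>P. \<exists>x y z t :: nat.
           x > 0 \<and> y > 0 \<and> z > 0 \<and> t > 0 \<and>
           (int x)\<^sup>2 - a * (int y)\<^sup>2 = poly P (int t) * (int z)\<^sup>2 \<and>
           real (Max {x, y, z, t}) \<le>
             real_of_int \<bar>a\<bar> powr (1 / 2) * real_of_int (height P) powr (1 / 2) *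
             ln (real_of_int (height P)) powr (real d / 2 + \<epsilon>))"
  (is "positive_proportion d ?Q")
proof -
  define C where "C = 73984 * real_of_int \<bar>a\<bar> ^ 3 * (real_of_int (value_const d))\<^sup>2"
  have C: "C > 0" using assms value_const_ge[of d] by (simp add: C_def)
  \<comment> \<open>At least \<open>h ^ (d + 1) / C\<close> polynomials have the property, and at
    most \<open>(7 * h) ^ (d + 1)\<close> are counted in all.\<close>
  define \<kappa> where "\<kappa> = 1 / (C * 7 ^ (d + 1))"
  have \<kappa>: "\<kappa> > 0" using C by (simp add: \<kappa>_def)
  have "filterlim (\<lambda>H :: nat. H div 2) sequentially sequentially"
    by (rule filterlim_at_top_div_const_nat) simp
  then have "\<forall>\<^sub>F H in sequentially. conic_family a (int (H div 2)) \<lceil>ln (real (H div 2))\<rceil> d \<and>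
    2 * sqrt (value_const d * \<lceil>ln (real (H div 2))\<rceil> ^ d) \<le> ln (real (H div 2)) powr (d / 2 + \<epsilon>)"
    using eventually_conic_family[OF assms] by (rule eventually_compose_filterlim[rotated])
  moreover have "\<forall>\<^sub>F H :: nat in sequentially. H \<ge> 2" by (rule eventually_ge_at_top)
  ultimately have "\<forall>\<^sub>F H in sequentially. ereal \<kappa> \<le>
    ereal (real (card {P \<in> polys_of_height_at_most d H. ?Q P}) / real (card (polys_of_height_at_most d H)))"
  proof eventually_elim
    case (elim H)
    define h where "h = H div 2"
    \<comment> \<open>From \<open>H \<le> 2 * h + 1\<close> follows
      \<open>2 * H + 1 \<le> 4 * h + 3\<close>, and \<open>h \<ge> 1\<close> turns this into
      \<open>7 * h\<close>.\<close>
    have h: "h \<ge> 1" "2 * h \<le> H" "2 * H + 1 \<le> 7 * h"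
      using elim(2) unfolding h_def by presburger+
    interpret conic_family a "int h" "\<lceil>ln (real h)\<rceil>" d using elim(1) by (simp add: h_def)
    let ?N = "real (card {P \<in> polys_of_height_at_most d H. ?Q P})"
    let ?D = "real (card (polys_of_height_at_most d H))"
    have N: "real h ^ (d + 1) / C \<le> ?N"
      using card_polys_with_small_solution_ge[of H "d / 2 + \<epsilon>"] elim(1) h assms
      by (simp add: C_def h_def)
    have "card (polys_of_height_at_most d H) \<le> (2 * H + 1) ^ (d + 1)"
      by (rule card_polys_of_height_at_most_le)
    also have "\<dots> \<le> (7 * h) ^ (d + 1)" using h by (intro power_mono) auto
    finally have D: "?D \<le> real ((7 * h) ^ (d + 1))" by (simp only: of_nat_le_iff)
    \<comment> \<open>The quotient needs a positive denominator, which the polynomials with the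
      property provide.\<close>
    have pos: "real h ^ (d + 1) / C > 0" using h C by simp
    then have "?N > 0" using N by linarith
    moreover have "?N \<le> ?D"
      unfolding of_nat_le_iff by (intro card_mono finite_polys_of_height_at_most) blast
    ultimately have D0: "?D > 0" by (rule order_less_le_trans)
    have "\<kappa> * ?D \<le> \<kappa> * real ((7 * h) ^ (d + 1))" using D \<kappa> by (intro mult_left_mono) auto
    also have "\<dots> = real h ^ (d + 1) / C" using C by (simp add: \<kappa>_def power_mult_distrib)
    also have "\<dots> \<le> ?N" by (rule N)
    finally show ?case using D0 by (simp add: pos_le_divide_eq)
  qed
  then have "ereal \<kappa> \<le> liminf (\<lambda>H. ereal (real (card {P \<in> polys_of_height_at_most d H. ?Q P}) /
      real (card (polys_of_height_at_most d H))))"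
    by (rule Liminf_bounded)
  moreover have "0 < ereal \<kappa>" using \<kappa> by simp
  ultimately show ?thesis unfolding positive_proportion_def by (rule order_less_le_trans[rotated])
qed

end
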